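(* There is an algorithm that, given a graph $G$ with $n$ vertices and $m$ edges, enumerates all minimal vertex covers of $G$ in time $O(2^{vc(G)}\cdot(m+n))$. Consequently, there is an $O^*(2^{vc(G)})$-time algorithm deciding whether $G$ is well covered, i.e. an FPT algorithm parameterized by $vc(G)$.
   Context: A vertex cover of $G$ is a set of vertices containing at least one endpoint of every edge; it is minimal if no proper subset is a vertex cover. $vc(G)$ is the size of a minimum vertex cover. $G$ is well covered if all minimal vertex covers of $G$ have the same size (equivalently, all maximal independent sets have the same size). A running time is $O^*(f(k))$ if it is $O(f(k)\cdot n^c)$ for some constant $c$. *)

theory Defs
  imports Main
begin

definition simple_graph :: "'a set \<Rightarrow> 'a set set \<Rightarrow> bool" where
  "simple_graph V E \<longleftrightarrow> finite V \<and> (\<forall>e\<in>E. e \<subseteq> V \<and> card e = 2)"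

definition vertex_cover :: "'a set \<Rightarrow> 'a set set \<Rightarrow> 'a set \<Rightarrow> bool" where
  "vertex_cover V E C \<longleftrightarrow> C \<subseteq> V \<and> (\<forall>e\<in>E. e \<inter> C \<noteq> {})"

definition minimal_vertex_cover :: "'a set \<Rightarrow> 'a set set \<Rightarrow> 'a set \<Rightarrow> bool" where
  "minimal_vertex_cover V E C \<longleftrightarrow>
     vertex_cover V E C \<and> (\<forall>D. D \<subset> C \<longrightarrow> \<not> vertex_cover V E D)"

definition vc :: "'a set \<Rightarrow> 'a set set \<Rightarrow> nat" where
  "vc V E = Min (card ` {C. vertex_cover V E C})"

definition well_covered :: "'a set \<Rightarrow> 'a set set \<Rightarrow> bool" where
  "well_covered V E \<longleftrightarrow>
     (\<forall>C D. minimal_vertex_cover V E C \<longrightarrow> minimal_vertex_cover V E D \<longrightarrow> card C = card D)"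

text \<open>Algorithms are programs of a uniform-cost random access machine in the style of
  Cook and Reckhow: registers hold natural numbers, subtraction is truncated, every
  instruction costs one step, input is read from and output is appended to a sequential
  stream. There is no multiplication, so the uniform cost measure is polynomially related
  to Turing machine time. A jump or fall-through to an address outside the program halts.\<close>

datatype instr =
    LI nat nat         \<comment> \<open>\<open>LI i c\<close>: R[i] := c\<close>
  | ADD nat nat nat    \<comment> \<open>\<open>ADD i j k\<close>: R[i] := R[j] + R[k]\<close>
  | SUB nat nat nat    \<comment> \<open>\<open>SUB i j k\<close>: R[i] := R[j] - R[k]\<close>
  | LOAD nat nat       \<comment> \<open>\<open>LOAD i j\<close>: R[i] := R[R[j]]\<close>
  | STORE nat nat      \<comment> \<open>\<open>STORE i j\<close>: R[R[i]] := R[j]\<close>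
  | JPOS nat nat       \<comment> \<open>\<open>JPOS i l\<close>: if R[i] > 0 then go to l\<close>
  | READ nat           \<comment> \<open>next input number into R[i]; 0 if the input is exhausted\<close>
  | PRINT nat          \<comment> \<open>append R[i] to the output\<close>

type_synonym program = "instr list"

record config =
  pc :: nat
  regs :: "nat \<Rightarrow> nat"
  inp :: "nat list"
  outp :: "nat list"

fun exec :: "instr \<Rightarrow> config \<Rightarrow> config" where
  "exec (LI i c) s = s\<lparr>pc := pc s + 1, regs := (regs s)(i := c)\<rparr>"
| "exec (ADD i j k) s = s\<lparr>pc := pc s + 1, regs := (regs s)(i := regs s j + regs s k)\<rparr>"
| "exec (SUB i j k) s = s\<lparr>pc := pc s + 1, regs := (regs s)(i := regs s j - regs s k)\<rparr>"
| "exec (LOAD i j) s = s\<lparr>pc := pc s + 1, regs := (regs s)(i := regs s (regs s j))\<rparr>"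
| "exec (STORE i j) s = s\<lparr>pc := pc s + 1, regs := (regs s)(regs s i := regs s j)\<rparr>"
| "exec (JPOS i l) s = s\<lparr>pc := (if regs s i > 0 then l else pc s + 1)\<rparr>"
| "exec (READ i) s = s\<lparr>pc := pc s + 1,
      regs := (regs s)(i := (case inp s of [] \<Rightarrow> 0 | x # _ \<Rightarrow> x)), inp := tl (inp s)\<rparr>"
| "exec (PRINT i) s = s\<lparr>pc := pc s + 1, outp := outp s @ [regs s i]\<rparr>"

definition halted :: "program \<Rightarrow> config \<Rightarrow> bool" where
  "halted p s \<longleftrightarrow> length p \<le> pc s"

definition step :: "program \<Rightarrow> config \<Rightarrow> config" where
  "step p s = (if halted p s then s else exec (p ! pc s) s)"

definition run :: "program \<Rightarrow> nat list \<Rightarrow> nat \<Rightarrow> config" where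
  "run p xs t = (step p ^^ t) \<lparr>pc = 0, regs = (\<lambda>_. 0), inp = xs, outp = []\<rparr>"

definition terminates :: "program \<Rightarrow> nat list \<Rightarrow> bool" where
  "terminates p xs \<longleftrightarrow> (\<exists>t. halted p (run p xs t))"

definition running_time :: "program \<Rightarrow> nat list \<Rightarrow> nat" where
  "running_time p xs = (LEAST t. halted p (run p xs t))"

definition result :: "program \<Rightarrow> nat list \<Rightarrow> nat list" where
  "result p xs = outp (run p xs (running_time p xs))"

definition computable :: "(nat \<Rightarrow> nat) \<Rightarrow> bool" where
  "computable f \<longleftrightarrow> (\<exists>p. \<forall>k. terminates p [k] \<and> result p [k] = [f k])"

text \<open>A graph on the vertices 0, ..., n-1 is presented as n, m and then the m edges,
  in any order and each edge in either orientation.\<close>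

definition encodes_graph :: "nat list \<Rightarrow> nat set \<Rightarrow> nat set set \<Rightarrow> bool" where
  "encodes_graph xs V E \<longleftrightarrow> simple_graph V E \<and> V = {..<card V} \<and>
     (\<exists>es :: (nat \<times> nat) list.
        distinct (map (\<lambda>(u, v). {u, v}) es) \<and> set (map (\<lambda>(u, v). {u, v}) es) = E \<and>
        xs = card V # card E # concat (map (\<lambda>(u, v). [u, v]) es))"

text \<open>A family of finite sets is listed set by set, each one exactly once, in any order,
  as its cardinality followed by its elements without repetition.\<close>

definition lists_family :: "nat list \<Rightarrow> nat set set \<Rightarrow> bool" where
  "lists_family ys F \<longleftrightarrow>
     (\<exists>ls. ys = concat (map (\<lambda>l. length l # l) ls) \<and> (\<forall>l\<in>set ls. distinct l) \<and>
           distinct (map set ls) \<and> set (map set ls) = F)"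

definition enumerates_minimal_vertex_covers :: "program \<Rightarrow> bool" where
  "enumerates_minimal_vertex_covers p \<longleftrightarrow>
     (\<forall>V E xs. encodes_graph xs V E \<longrightarrow>
        terminates p xs \<and> lists_family (result p xs) {C. minimal_vertex_cover V E C})"

definition decides_well_covered :: "program \<Rightarrow> bool" where
  "decides_well_covered p \<longleftrightarrow>
     (\<forall>V E xs. encodes_graph xs V E \<longrightarrow>
        terminates p xs \<and> result p xs = [if well_covered V E then 1 else 0])"

text \<open>The graph without vertices is exempt from time bounds only: there the bounds below
  may evaluate to 0, which no program that produces output can meet.\<close>

definition time_O :: "program \<Rightarrow> (nat set \<Rightarrow> nat set set \<Rightarrow> nat) \<Rightarrow> bool" where
  "time_O p B \<longleftrightarrow>
     (\<exists>c. \<forall>V E xs. encodes_graph xs V E \<longrightarrow> V \<noteq> {} \<longrightarrow> running_time p xs \<le> c * B V E)"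

definition time_Ostar ::
    "program \<Rightarrow> (nat set \<Rightarrow> nat set set \<Rightarrow> nat) \<Rightarrow> (nat \<Rightarrow> nat) \<Rightarrow> bool" where
  "time_Ostar p \<kappa> f \<longleftrightarrow> (\<exists>d. time_O p (\<lambda>V E. f (\<kappa> V E) * card V ^ d))"

definition fpt_time :: "program \<Rightarrow> (nat set \<Rightarrow> nat set set \<Rightarrow> nat) \<Rightarrow> bool" where
  "fpt_time p \<kappa> \<longleftrightarrow> (\<exists>f. computable f \<and> time_Ostar p \<kappa> f)"

end

theory Submission imports Defs begin

text \<open>
  Let \<open>X\<close> be a minimum vertex cover. A minimal vertex cover \<open>C\<close> is determined by the set
  \<open>D = X - C\<close>, since minimality forces \<open>C = (X - D) \<union> N(D)\<close>. Hence it suffices to run through the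
  \<open>2 ^ vc\<close> subsets \<open>D\<close> of \<open>X\<close> and to keep those for which \<open>C\<close> avoids \<open>D\<close> and every vertex of \<open>C\<close>
  has a neighbour outside \<open>C\<close>; both conditions are checked in linear time.

  To find \<open>X\<close>, the search tree of depth \<open>k\<close> is traversed without recursion: a number \<open>y < 2 ^ k\<close>
  encodes one branch, whose bits tell which endpoint of the next uncovered edge to take. Trying
  \<open>k = 0, 1, ...\<close> until a branch takes at most \<open>k\<close> vertices costs \<open>O(2 ^ vc)\<close> linear scans.
  Bits are read without division, most significant first, by doubling and comparing with \<open>2 ^ k\<close>.

  The machine programs are compiled from a language whose only loops are bounded, so that
  its semantics and its cost are total functions.
\<close>

section \<open>Bounded-loop programs and their compilation\<close>

text \<open>The bound leaves no room for a further factor \<open>vc V E\<close> or \<open>n\<close>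
  beside \<open>2 ^ vc V E\<close>. The rounds of the search form a geometric sum, so the last one,
  \<open>k = vc V E\<close>, dominates. That round must succeed because a minimum cover can act as
  an oracle: taking at each uncovered edge an endpoint inside it spends one of its vertices per bit,
  hence at most \<open>k\<close> bits.

  Listing every cover exactly once requires no record of what was printed. The numbers below
  \<open>2 ^ card X\<close> are in bijection with the subsets \<open>D\<close>, and \<open>D\<close>
  can be recovered from an accepted \<open>C\<close> as \<open>X - C\<close>. Likewise no sizes have
  to be remembered when deciding well-coveredness: \<open>X\<close> is itself a minimal cover, so
  every other one is compared with \<open>card X\<close> only.

  Since the machine neither multiplies nor divides, the powers \<open>2 ^ k\<close> and
  \<open>2 ^ card X\<close> are maintained by doubling instead of being computed from their
  exponents.\<close>

datatype com =
    Const nat nat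
  | Plus nat nat nat
  | Minus nat nat nat
  | Get nat nat nat
  | Put nat nat nat
  | Input nat
  | Output nat
  | Skip
  | Seq com com (infixr ";;" 60)
  | Cond nat com com
  | For nat nat com

record state =
  vr :: "nat \<Rightarrow> nat"
  ar :: "nat \<Rightarrow> nat \<Rightarrow> nat"
  sin :: "nat list"
  sout :: "nat list"

text \<open>Loops count down: the body sees the indices \<open>n - 1, ..., 0\<close> in this order.\<close>

primrec loop :: "(nat \<Rightarrow> 's \<Rightarrow> 's) \<Rightarrow> nat \<Rightarrow> 's \<Rightarrow> 's" where
  "loop f 0 s = s"
| "loop f (Suc i) s = loop f i (f i s)"

primrec loop_cost :: "(nat \<Rightarrow> 's \<Rightarrow> 's) \<Rightarrow> (nat \<Rightarrow> 's \<Rightarrow> nat) \<Rightarrow> nat \<Rightarrow> 's \<Rightarrow> nat" where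
  "loop_cost f g 0 s = 0"
| "loop_cost f g (Suc i) s = g i s + loop_cost f g i (f i s)"

abbreviation setv :: "nat \<Rightarrow> nat \<Rightarrow> state \<Rightarrow> state" where
  "setv x k s \<equiv> s\<lparr>vr := (vr s)(x := k)\<rparr>"

primrec sem :: "com \<Rightarrow> state \<Rightarrow> state" where
  "sem (Const x k) s = setv x k s"
| "sem (Plus x y z) s = setv x (vr s y + vr s z) s"
| "sem (Minus x y z) s = setv x (vr s y - vr s z) s"
| "sem (Get x a y) s = setv x (ar s a (vr s y)) s"
| "sem (Put a x y) s = s\<lparr>ar := (ar s)(a := (ar s a)(vr s x := vr s y))\<rparr>"
| "sem (Input x) s = (setv x (case sin s of [] \<Rightarrow> 0 | k # _ \<Rightarrow> k) s)\<lparr>sin := tl (sin s)\<rparr>"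
| "sem (Output x) s = s\<lparr>sout := sout s @ [vr s x]\<rparr>"
| "sem Skip s = s"
| "sem (c ;; d) s = sem d (sem c s)"
| "sem (Cond x c d) s = (if vr s x > 0 then sem c s else sem d s)"
| "sem (For x y c) s = loop (\<lambda>i s. sem c (setv x i s)) (vr s y) s"

primrec cost :: "com \<Rightarrow> state \<Rightarrow> nat" where
  "cost (Const x k) s = 1"
| "cost (Plus x y z) s = 1"
| "cost (Minus x y z) s = 1"
| "cost (Get x a y) s = 6"
| "cost (Put a x y) s = 6"
| "cost (Input x) s = 1"
| "cost (Output x) s = 1"
| "cost Skip s = 0"
| "cost (c ;; d) s = cost c s + cost d (sem c s)"
| "cost (Cond x c d) s = (if vr s x > 0 then 1 + cost c s else 2 + cost d s)"
| "cost (For x y c) s =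
     3 + loop_cost (\<lambda>i s. sem c (setv x i s)) (\<lambda>i s. 3 + cost c (setv x i s)) (vr s y) s"

primrec csize :: "com \<Rightarrow> nat" where
  "csize (Const x k) = 1"
| "csize (Plus x y z) = 1"
| "csize (Minus x y z) = 1"
| "csize (Get x a y) = 6"
| "csize (Put a x y) = 6"
| "csize (Input x) = 1"
| "csize (Output x) = 1"
| "csize Skip = 0"
| "csize (c ;; d) = csize c + csize d"
| "csize (Cond x c d) = 2 + csize c + csize d"
| "csize (For x y c) = 5 + csize c"

text \<open>Registers 0 and 1 hold the constants 0 and 1, registers 2 and 3 are used for address
  computations, register \<open>4 + d\<close> is the counter of a loop at nesting depth \<open>d < 16\<close>, registers
  20 to 59 hold the scalar variables, and the cell \<open>j\<close> of the array \<open>a < 8\<close> is the register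
  \<open>64 + a + 8 * j\<close>.\<close>

abbreviation (input) reg :: "nat \<Rightarrow> nat" where
  "reg x \<equiv> 20 + x"

primrec code :: "nat \<Rightarrow> nat \<Rightarrow> com \<Rightarrow> program" where
  "code d l (Const x k) = [LI (reg x) k]"
| "code d l (Plus x y z) = [ADD (reg x) (reg y) (reg z)]"
| "code d l (Minus x y z) = [SUB (reg x) (reg y) (reg z)]"
| "code d l (Get x a y) =
     [ADD 2 (reg y) (reg y), ADD 2 2 2, ADD 2 2 2, LI 3 (64 + a), ADD 2 2 3, LOAD (reg x) 2]"
| "code d l (Put a x y) =
     [ADD 2 (reg x) (reg x), ADD 2 2 2, ADD 2 2 2, LI 3 (64 + a), ADD 2 2 3, STORE 2 (reg y)]"
| "code d l (Input x) = [READ (reg x)]"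
| "code d l (Output x) = [PRINT (reg x)]"
| "code d l Skip = []"
| "code d l (c ;; c') = code d l c @ code d (l + csize c) c'"
| "code d l (Cond x c c') =
     JPOS (reg x) (l + csize c' + 2) # code d (l + 1) c' @
     JPOS 1 (l + csize c' + csize c + 2) # code d (l + csize c' + 2) c"
| "code d l (For x y c) =
     ADD (4 + d) (reg y) 0 # JPOS 1 (l + csize c + 4) # SUB (reg x) (4 + d) 1 #
     code (Suc d) (l + 3) c @ [SUB (4 + d) (4 + d) 1, JPOS (4 + d) (l + 2)]"

primrec well_formed :: "nat \<Rightarrow> com \<Rightarrow> bool" where
  "well_formed d (Const x k) \<longleftrightarrow> x < 40"
| "well_formed d (Plus x y z) \<longleftrightarrow> x < 40 \<and> y < 40 \<and> z < 40"
| "well_formed d (Minus x y z) \<longleftrightarrow> x < 40 \<and> y < 40 \<and> z < 40"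
| "well_formed d (Get x a y) \<longleftrightarrow> x < 40 \<and> a < 8 \<and> y < 40"
| "well_formed d (Put a x y) \<longleftrightarrow> x < 40 \<and> a < 8 \<and> y < 40"
| "well_formed d (Input x) \<longleftrightarrow> x < 40"
| "well_formed d (Output x) \<longleftrightarrow> x < 40"
| "well_formed d Skip \<longleftrightarrow> True"
| "well_formed d (c ;; c') \<longleftrightarrow> well_formed d c \<and> well_formed d c'"
| "well_formed d (Cond x c c') \<longleftrightarrow> x < 40 \<and> well_formed d c \<and> well_formed d c'"
| "well_formed d (For x y c) \<longleftrightarrow> d < 16 \<and> x < 40 \<and> y < 40 \<and> well_formed (Suc d) c"

lemma length_code [simp]: "length (code d l c) = csize c"
  by (induction c arbitrary: d l) simp_all

primrec code_at :: "program \<Rightarrow> nat \<Rightarrow> program \<Rightarrow> bool" where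
  "code_at p l [] \<longleftrightarrow> True"
| "code_at p l (i # is) \<longleftrightarrow> l < length p \<and> p ! l = i \<and> code_at p (Suc l) is"

lemma code_at_append [simp]:
  "code_at p l (is @ js) \<longleftrightarrow> code_at p l is \<and> code_at p (l + length is) js"
  by (induction "is" arbitrary: l) simp_all

lemma code_at_suffix: "code_at (is @ js) (length is) js"
proof (induction js arbitrary: "is")
  case (Cons j js)
  from Cons[of "is @ [j]"] show ?case by simp
qed simp

text \<open>Registers 2 and 3 and the loop counters are left free, so address computations and
  counter updates preserve the relation.\<close>

definition sim :: "state \<Rightarrow> config \<Rightarrow> bool" where
  "sim s cf \<longleftrightarrow> regs cf 0 = 0 \<and> regs cf (Suc 0) = 1 \<and> (\<forall>x<40. regs cf (reg x) = vr s x) \<and>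
     (\<forall>a<8. \<forall>j. regs cf (64 + a + 8 * j) = ar s a j) \<and> inp cf = sin s \<and> outp cf = sout s"

lemma step_code: "pc cf < length p \<Longrightarrow> step p cf = exec (p ! pc cf) cf"
  by (simp add: step_def halted_def)

lemma funpow_trans: "(f ^^ m) x = y \<Longrightarrow> (f ^^ n) y = z \<Longrightarrow> (f ^^ (m + n)) x = z"
  by (simp add: add.commute[of m n] funpow_add)

lemma funpow_6: "(f ^^ 6) x = f (f (f (f (f (f x)))))"
  by (simp add: numeral_eq_Suc)

lemma funpow_2: "(f ^^ 2) x = f (f x)"
  by (simp add: numeral_eq_Suc)

text \<open>Residues modulo 8 separate the arrays, so each of them may grow without bound. The
  factor 8 costs three doublings.\<close>

lemma address_eq: "a < 8 \<Longrightarrow> b < 8 \<Longrightarrow> a + 8 * i = b + 8 * j \<longleftrightarrow> a = b \<and> i = (j::nat)"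
  by presburger

text \<open>The number of machine steps is exactly \<open>cost c s\<close>, so one induction yields
  both correctness and time. The clause on the registers \<open>4 + h\<close> with
  \<open>h < d\<close> is there for the \<open>For\<close> case: a body must leave the counters of
  the enclosing loops intact. The index variable is a copy of the counter and may be overwritten by
  the body.\<close>

lemma code_correct:
  assumes "well_formed d c" "d \<le> 16" "sim s cf" "pc cf = l" "code_at p l (code d l c)"
  shows "\<exists>cf'. (step p ^^ cost c s) cf = cf' \<and> sim (sem c s) cf' \<and> pc cf' = l + csize c \<and>
    (\<forall>h<d. regs cf' (4 + h) = regs cf (4 + h))"
  using assms
proof (induction c arbitrary: d l s cf)
  case (Const x k)
  then show ?case by (auto simp: step_code sim_def)
next
  case (Plus x y z)
  then show ?case by (auto simp: step_code sim_def)
next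
  case (Minus x y z)
  then show ?case by (auto simp: step_code sim_def)
next
  case (Get x a y)
  have "regs cf (8 * vr s y + (64 + a)) = ar s a (vr s y)"
    using Get by (simp add: sim_def add.commute[of "8 * vr s y"])
  then have "(step p ^^ cost (Get x a y) s) cf = cf\<lparr>pc := Suc (Suc (Suc (Suc (Suc (Suc l))))), regs :=
      (regs cf)(3 := 64 + a, 2 := 8 * vr s y + (64 + a), reg x := ar s a (vr s y))\<rparr>"
    unfolding cost.simps funpow_6 using Get by (simp add: step_code sim_def fun_upd_twist)
  with Get show ?case by (auto simp: sim_def)
next
  case (Put a x y)
  have "(step p ^^ cost (Put a x y) s) cf = cf\<lparr>pc := Suc (Suc (Suc (Suc (Suc (Suc l))))), regs :=
      (regs cf)(3 := 64 + a, 2 := 8 * vr s x + (64 + a), 64 + a + 8 * vr s x := vr s y)\<rparr>"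
    unfolding cost.simps funpow_6
    using Put by (simp add: step_code sim_def fun_upd_twist add.commute[of "8 * vr s x"])
  with Put show ?case by (auto simp: sim_def address_eq)
next
  case (Input x)
  then show ?case by (auto simp: step_code sim_def)
next
  case (Output x)
  then show ?case by (auto simp: step_code sim_def)
next
  case Skip
  then show ?case by simp
next
  case (Seq c c')
  obtain cf1 where 1: "(step p ^^ cost c s) cf = cf1" "sim (sem c s) cf1" "pc cf1 = l + csize c"
    "\<forall>h<d. regs cf1 (4 + h) = regs cf (4 + h)"
    using Seq.IH(1)[of d s cf l] Seq.prems by auto
  obtain cf2 where 2: "(step p ^^ cost c' (sem c s)) cf1 = cf2" "sim (sem c' (sem c s)) cf2"
    "pc cf2 = l + csize c + csize c'" "\<forall>h<d. regs cf2 (4 + h) = regs cf1 (4 + h)"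
    using Seq.IH(2)[of d "sem c s" cf1 "l + csize c"] Seq.prems 1 by auto
  show ?case using funpow_trans[OF 1(1) 2(1)] 1 2 by auto
next
  case (Cond x c c')
  have test: "step p cf = cf\<lparr>pc := if vr s x > 0 then l + csize c' + 2 else l + 1\<rparr>"
    using Cond.prems by (auto simp: step_code sim_def)
  show ?case
  proof (cases "vr s x > 0")
    case True
    let ?start = "cf\<lparr>pc := l + csize c' + 2\<rparr>"
    have "sim s ?start" using Cond.prems by (simp add: sim_def)
    then obtain cf1 where 1: "(step p ^^ cost c s) ?start = cf1" "sim (sem c s) cf1"
      "pc cf1 = l + csize c' + 2 + csize c" "\<forall>h<d. regs cf1 (4 + h) = regs cf (4 + h)"
      using Cond.IH(1)[of d s ?start "l + csize c' + 2"] Cond.prems by auto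
    have "(step p ^^ 1) cf = ?start" using True test by simp
    from funpow_trans[OF this 1(1)] show ?thesis using True 1 by auto
  next
    case False
    let ?start = "cf\<lparr>pc := l + 1\<rparr>"
    have "sim s ?start" using Cond.prems by (simp add: sim_def)
    then obtain cf1 where 1: "(step p ^^ cost c' s) ?start = cf1" "sim (sem c' s) cf1"
      "pc cf1 = l + 1 + csize c'" "\<forall>h<d. regs cf1 (4 + h) = regs cf (4 + h)"
      using Cond.IH(2)[of d s ?start "l + 1"] Cond.prems by auto
    have 0: "(step p ^^ 1) cf = ?start" using False test by simp
    have 2: "(step p ^^ 1) cf1 = cf1\<lparr>pc := l + csize c' + csize c + 2\<rparr>"
      using 1 Cond.prems by (simp add: step_code sim_def)
    have "(step p ^^ cost (Cond x c c') s) cf = cf1\<lparr>pc := l + csize c' + csize c + 2\<rparr>"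
      using funpow_trans[OF funpow_trans[OF 0 1(1)] 2] False by simp
    moreover have "sim (sem (Cond x c c') s) (cf1\<lparr>pc := l + csize c' + csize c + 2\<rparr>)"
      using 1 False by (simp add: sim_def)
    ultimately show ?thesis using 1 by simp
  qed
next
  case (For x y c)
  let ?f = "\<lambda>i s. sem c (setv x i s)" and ?g = "\<lambda>i s. 3 + cost c (setv x i s)"
  have "l + csize c + 4 < length p" and
      "p ! (l + csize c + 3) = SUB (4 + d) (4 + d) 1" and
      "p ! (l + csize c + 4) = JPOS (4 + d) (l + 2)" and "p ! (l + 2) = SUB (reg x) (4 + d) 1" and
      "code_at p (l + 3) (code (Suc d) (l + 3) c)"
    using For.prems by (simp_all add: numeral_eq_Suc)
  note at = this
  \<comment> \<open>The loop is entered at its test, so zero iterations need no special treatment.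
    An iteration adds 3 steps to the body: test, index assignment and decrement. The extra 1 is the
    final, failing test.\<close>
  have iter: "\<exists>cf'. (step p ^^ (1 + loop_cost ?f ?g i s)) cf = cf' \<and> sim (loop ?f i s) cf' \<and>
      pc cf' = l + csize c + 5 \<and> (\<forall>h<d. regs cf' (4 + h) = regs cf (4 + h))"
    if "sim s cf" "pc cf = l + csize c + 4" "regs cf (4 + d) = i" for i s cf
    using that
  proof (induction i arbitrary: s cf)
    case 0
    then have "(step p ^^ 1) cf = cf\<lparr>pc := l + csize c + 5\<rparr>"
      using at by (simp add: step_code)
    with 0 show ?case by (simp add: sim_def)
  next
    case (Suc i)
    let ?start = "cf\<lparr>pc := l + 3, regs := (regs cf)(reg x := i)\<rparr>"
    have 0: "(step p ^^ 2) cf = ?start"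
      using Suc.prems For.prems at by (simp add: step_code sim_def funpow_2)
    have "sim (setv x i s) ?start" using Suc.prems For.prems by (simp add: sim_def)
    then obtain cf1 where 1: "(step p ^^ cost c (setv x i s)) ?start = cf1"
      "sim (?f i s) cf1" "pc cf1 = l + 3 + csize c"
      "\<forall>h<Suc d. regs cf1 (4 + h) = regs ?start (4 + h)"
      using For.IH[of "Suc d" "setv x i s" ?start "l + 3"] For.prems at by auto
    let ?back = "cf1\<lparr>pc := l + csize c + 4, regs := (regs cf1)(4 + d := i)\<rparr>"
    have d: "regs cf1 (4 + d) = Suc i" using 1(4) Suc.prems For.prems by auto
    have 2: "(step p ^^ 1) cf1 = ?back"
      using 1(2,3) d at by (simp add: step_code sim_def add.commute add.left_commute)
    have "sim (?f i s) ?back" using 1(2) For.prems by (auto simp: sim_def)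
    moreover have "pc ?back = l + csize c + 4" "regs ?back (4 + d) = i" by simp_all
    ultimately obtain cf3 where 3: "(step p ^^ (1 + loop_cost ?f ?g i (?f i s))) ?back = cf3"
      "sim (loop ?f i (?f i s)) cf3" "pc cf3 = l + csize c + 5"
      "\<forall>h<d. regs cf3 (4 + h) = regs ?back (4 + h)" using Suc.IH by blast
    have "2 + cost c (setv x i s) + 1 + (1 + loop_cost ?f ?g i (?f i s)) =
        1 + loop_cost ?f ?g (Suc i) s" by simp
    with funpow_trans[OF funpow_trans[OF funpow_trans[OF 0 1(1)] 2] 3(1)]
    have "(step p ^^ (1 + loop_cost ?f ?g (Suc i) s)) cf = cf3" by metis
    moreover have "\<forall>h<d. regs cf3 (4 + h) = regs cf (4 + h)"
      using 3(4) 1(4) For.prems by auto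
    moreover have "sim (loop ?f (Suc i) s) cf3" using 3(2) by simp
    ultimately show ?case using 3(3) by blast
  qed
  let ?start = "cf\<lparr>pc := l + csize c + 4, regs := (regs cf)(4 + d := vr s y)\<rparr>"
  have 0: "(step p ^^ 2) cf = ?start"
    using For.prems by (simp add: step_code sim_def funpow_2)
  have "sim s ?start" using For.prems by (simp add: sim_def)
  moreover have "pc ?start = l + csize c + 4" "regs ?start (4 + d) = vr s y" by simp_all
  ultimately obtain cf1 where 1: "(step p ^^ (1 + loop_cost ?f ?g (vr s y) s)) ?start = cf1"
    "sim (loop ?f (vr s y) s) cf1" "pc cf1 = l + csize c + 5"
    "\<forall>h<d. regs cf1 (4 + h) = regs ?start (4 + h)" using iter by blast
  have "2 + (1 + loop_cost ?f ?g (vr s y) s) = cost (For x y c) s" by simp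
  with funpow_trans[OF 0 1(1)] have "(step p ^^ cost (For x y c) s) cf = cf1" by metis
  moreover have "\<forall>h<d. regs cf1 (4 + h) = regs cf (4 + h)" using 1(4) by auto
  moreover have "sim (sem (For x y c) s) cf1" using 1(2) by simp
  moreover have "pc cf1 = l + csize (For x y c)" using 1(3) by simp
  ultimately show ?case by blast
qed

definition ram :: "com \<Rightarrow> program" where
  "ram c = LI 1 1 # code 0 1 c"

definition init :: "nat list \<Rightarrow> state" where
  "init xs = \<lparr>vr = \<lambda>_. 0, ar = \<lambda>_ _. 0, sin = xs, sout = []\<rparr>"

lemma run_halted: "halted p (run p xs t) \<Longrightarrow> t \<le> t' \<Longrightarrow> run p xs t' = run p xs t"
proof (induction t')
  case (Suc t')
  then show ?case by (auto simp: run_def step_def le_Suc_eq)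
qed simp

theorem ram_correct:
  assumes "well_formed 0 c"
  shows "terminates (ram c) xs" "result (ram c) xs = sout (sem c (init xs))"
    "running_time (ram c) xs \<le> 1 + cost c (init xs)"
proof -
  let ?p = "ram c" and ?t = "1 + cost c (init xs)"
  let ?cf = "\<lparr>pc = 0, regs = \<lambda>_. 0, inp = xs, outp = []\<rparr>"
  let ?start = "?cf\<lparr>pc := 1, regs := (\<lambda>_. 0)(1 := 1)\<rparr>"
  have "step ?p ?cf = ?start" by (simp add: ram_def step_code)
  then have 0: "(step ?p ^^ 1) ?cf = ?start" by simp
  have "code_at ?p 1 (code 0 1 c)"
    using code_at_suffix[of "[LI 1 1]" "code 0 1 c"] by (simp add: ram_def)
  moreover have "sim (init xs) ?start" by (simp add: sim_def init_def)
  ultimately obtain cf' where cf': "(step ?p ^^ cost c (init xs)) ?start = cf'"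
    "sim (sem c (init xs)) cf'" "pc cf' = 1 + csize c"
    using code_correct[OF assms, of "init xs" ?start 1 ?p] by auto
  have run: "run ?p xs ?t = cf'" unfolding run_def using funpow_trans[OF 0 cf'(1)] .
  have halt: "halted ?p (run ?p xs ?t)" using cf'(3) run by (simp add: halted_def ram_def)
  show "terminates ?p xs" using halt unfolding terminates_def by blast
  show le: "running_time ?p xs \<le> ?t" unfolding running_time_def by (rule Least_le) (rule halt)
  \<comment> \<open>\<open>running_time\<close> is a least number and is only known to be at most
    \<open>?t\<close>. A halted configuration never changes, so the outputs at both times
    agree.\<close>
  have "halted ?p (run ?p xs (running_time ?p xs))"
    unfolding running_time_def by (rule LeastI) (rule halt)
  from run_halted[OF this le] show "result ?p xs = sout (sem c (init xs))"
    using run cf'(2) by (simp add: result_def sim_def)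
qed

section \<open>Loop invariants, frames and static cost bounds\<close>

lemma loop_inv:
  assumes "I n s" "\<And>i s. i < n \<Longrightarrow> I (Suc i) s \<Longrightarrow> I i (f i s)"
  shows "I 0 (loop f n s)"
  using assms by (induction n arbitrary: s) simp_all

text \<open>Carries what is proved about \<open>greedy\<close> and \<open>select\<close>, which are
  loops on plain mathematical data, over to the program loops.\<close>

lemma loop_sim:
  assumes "R n s a" "\<And>i s a. i < n \<Longrightarrow> R (Suc i) s a \<Longrightarrow> R i (f i s) (g i a)"
  shows "R 0 (loop f n s) (loop g n a)"
  using assms by (induction n arbitrary: s a) simp_all

text \<open>Here \<open>t\<close> is the cost accumulated so far. An invariant that mentions it can
  express amortised bounds, as for rounds of doubling cost, where a uniform bound per round would
  lose a factor.\<close>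

lemma loop_cost_inv:
  assumes "I n s t" "\<And>i s t. i < n \<Longrightarrow> I (Suc i) s t \<Longrightarrow> I i (f i s) (t + g i s)"
  shows "I 0 (loop f n s) (t + loop_cost f g n s)"
  using assms
proof (induction n arbitrary: s t)
  case (Suc n)
  from Suc.IH[of "f n s" "t + g n s"] Suc.prems show ?case by (simp add: add.assoc)
qed simp

lemma loop_cost_le:
  assumes "\<And>i s. I s \<Longrightarrow> I (f i s) \<and> g i s \<le> b" "I s"
  shows "loop_cost f g n s \<le> n * b"
  using assms(2)
proof (induction n arbitrary: s)
  case (Suc n)
  have "g n s \<le> b" "loop_cost f g n (f n s) \<le> n * b"
    using assms(1)[of s n] Suc.prems Suc.IH by auto
  then show ?case by simp
qed simp

primrec writes :: "com \<Rightarrow> nat set" where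
  "writes (Const x k) = {x}"
| "writes (Plus x y z) = {x}"
| "writes (Minus x y z) = {x}"
| "writes (Get x a y) = {x}"
| "writes (Put a x y) = {}"
| "writes (Input x) = {x}"
| "writes (Output x) = {}"
| "writes Skip = {}"
| "writes (c ;; d) = writes c \<union> writes d"
| "writes (Cond x c d) = writes c \<union> writes d"
| "writes (For x y c) = insert x (writes c)"

primrec array_writes :: "com \<Rightarrow> nat set" where
  "array_writes (Const x k) = {}"
| "array_writes (Plus x y z) = {}"
| "array_writes (Minus x y z) = {}"
| "array_writes (Get x a y) = {}"
| "array_writes (Put a x y) = {a}"
| "array_writes (Input x) = {}"
| "array_writes (Output x) = {}"
| "array_writes Skip = {}"
| "array_writes (c ;; d) = array_writes c \<union> array_writes d"
| "array_writes (Cond x c d) = array_writes c \<union> array_writes d"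
| "array_writes (For x y c) = array_writes c"

primrec silent :: "com \<Rightarrow> bool" where
  "silent (Const x k) = True"
| "silent (Plus x y z) = True"
| "silent (Minus x y z) = True"
| "silent (Get x a y) = True"
| "silent (Put a x y) = True"
| "silent (Input x) = True"
| "silent (Output x) = False"
| "silent Skip = True"
| "silent (c ;; d) = (silent c \<and> silent d)"
| "silent (Cond x c d) = (silent c \<and> silent d)"
| "silent (For x y c) = silent c"

primrec loop_vars :: "com \<Rightarrow> nat set" where
  "loop_vars (Const x k) = {}"
| "loop_vars (Plus x y z) = {}"
| "loop_vars (Minus x y z) = {}"
| "loop_vars (Get x a y) = {}"
| "loop_vars (Put a x y) = {}"
| "loop_vars (Input x) = {}"
| "loop_vars (Output x) = {}"
| "loop_vars Skip = {}"
| "loop_vars (c ;; d) = loop_vars c \<union> loop_vars d"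
| "loop_vars (Cond x c d) = loop_vars c \<union> loop_vars d"
| "loop_vars (For x y c) = insert y (loop_vars c)"

text \<open>The branches of \<open>Cond\<close> are added rather than maximised: the bound stays a
  polynomial in the loop bounds, which simplification can evaluate.\<close>

primrec cost_bound :: "com \<Rightarrow> (nat \<Rightarrow> nat) \<Rightarrow> nat" where
  "cost_bound (Const x k) \<sigma> = 1"
| "cost_bound (Plus x y z) \<sigma> = 1"
| "cost_bound (Minus x y z) \<sigma> = 1"
| "cost_bound (Get x a y) \<sigma> = 6"
| "cost_bound (Put a x y) \<sigma> = 6"
| "cost_bound (Input x) \<sigma> = 1"
| "cost_bound (Output x) \<sigma> = 1"
| "cost_bound Skip \<sigma> = 0"
| "cost_bound (c ;; d) \<sigma> = cost_bound c \<sigma> + cost_bound d \<sigma>"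
| "cost_bound (Cond x c d) \<sigma> = 2 + cost_bound c \<sigma> + cost_bound d \<sigma>"
| "cost_bound (For x y c) \<sigma> = 3 + \<sigma> y * (3 + cost_bound c \<sigma>)"

lemma vr_frame: "x \<notin> writes c \<Longrightarrow> vr (sem c s) x = vr s x"
proof (induction c arbitrary: s)
  case (For y z c)
  have "vr (loop (\<lambda>i s. sem c (setv y i s)) (vr s z) s) x = vr s x"
    by (rule loop_inv[where I = "\<lambda>i s'. vr s' x = vr s x"]) (use For in auto)
  then show ?case by simp
qed auto

lemma ar_frame: "a \<notin> array_writes c \<Longrightarrow> ar (sem c s) a = ar s a"
proof (induction c arbitrary: s)
  case (For y z c)
  have "ar (loop (\<lambda>i s. sem c (setv y i s)) (vr s z) s) a = ar s a"
    by (rule loop_inv[where I = "\<lambda>i s'. ar s' a = ar s a"]) (use For in auto)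
  then show ?case by simp
qed auto

lemma sout_frame: "silent c \<Longrightarrow> sout (sem c s) = sout s"
proof (induction c arbitrary: s)
  case (For y z c)
  have "sout (loop (\<lambda>i s. sem c (setv y i s)) (vr s z) s) = sout s"
    by (rule loop_inv[where I = "\<lambda>i s'. sout s' = sout s"]) (use For in auto)
  then show ?case by simp
qed auto

text \<open>If no loop bound is ever overwritten, all iteration counts are fixed at the start.
  \<open>find_cover\<close> doubles \<open>vP\<close>, the bound of a loop inside it, and therefore
  needs \<open>loop_cost_inv\<close> for its outer loop.\<close>

lemma cost_le_bound:
  assumes "loop_vars c \<inter> writes c = {}" "\<forall>x\<in>loop_vars c. vr s x = \<sigma> x"
  shows "cost c s \<le> cost_bound c \<sigma>"
  using assms
proof (induction c arbitrary: s)
  case (Seq c d)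
  have "cost c s \<le> cost_bound c \<sigma>" using Seq by auto
  moreover have "cost d (sem c s) \<le> cost_bound d \<sigma>"
  proof (rule Seq.IH(2))
    show "\<forall>x\<in>loop_vars d. vr (sem c s) x = \<sigma> x"
    proof
      fix x assume x: "x \<in> loop_vars d"
      then have "x \<notin> writes c" using Seq.prems by auto
      then show "vr (sem c s) x = \<sigma> x" using vr_frame x Seq.prems by simp
    qed
  qed (use Seq.prems in auto)
  ultimately show ?case by simp
next
  case (Cond x c d)
  have "cost c s \<le> cost_bound c \<sigma>" by (rule Cond.IH(1)) (use Cond.prems in auto)
  moreover have "cost d s \<le> cost_bound d \<sigma>" by (rule Cond.IH(2)) (use Cond.prems in auto)
  ultimately show ?case by simp
next
  case (For x y c)
  let ?I = "\<lambda>s :: state. \<forall>v\<in>loop_vars c. vr s v = \<sigma> v"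
  have "loop_cost (\<lambda>i s. sem c (setv x i s)) (\<lambda>i s. 3 + cost c (setv x i s)) (vr s y) s
      \<le> vr s y * (3 + cost_bound c \<sigma>)"
  proof (rule loop_cost_le[where I = ?I])
    fix i and s :: state assume s: "?I s"
    have "?I (sem c (setv x i s))"
    proof
      fix v assume v: "v \<in> loop_vars c"
      then have "v \<notin> writes c" "v \<noteq> x" using For.prems by auto
      then show "vr (sem c (setv x i s)) v = \<sigma> v" using v s by (simp add: vr_frame)
    qed
    moreover have "cost c (setv x i s) \<le> cost_bound c \<sigma>"
      by (rule For.IH) (use For.prems s in auto)
    ultimately show "?I (sem c (setv x i s)) \<and> 3 + cost c (setv x i s) \<le> 3 + cost_bound c \<sigma>"
      by simp
  qed (use For.prems in simp)
  then show ?case using For.prems by simp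
qed auto

section \<open>Numbers as sequences of binary choices\<close>

text \<open>Removes the most significant bit \<open>P \<le> 2 * z\<close> from \<open>z < P\<close>, where \<open>P\<close> is a power of 2.\<close>

definition shift :: "nat \<Rightarrow> nat \<Rightarrow> nat" where
  "shift P z = (if P \<le> 2 * z then 2 * z - P else 2 * z)"

text \<open>With \<open>r\<close> bits left to read, \<open>z\<close> has the form \<open>w * 2 ^ (k - r)\<close> with \<open>w < 2 ^ r\<close>.\<close>

lemma shift_prepend:
  assumes "r < k" "w < 2 ^ r"
  obtains w' where "w' < 2 ^ Suc r" "2 ^ k \<le> 2 * (w' * 2 ^ (k - Suc r)) \<longleftrightarrow> b"
    "shift (2 ^ k) (w' * 2 ^ (k - Suc r)) = w * 2 ^ (k - r)"
proof
  let ?w' = "(if b then 2 ^ r else 0) + w"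
  have k: "(2::nat) ^ k = 2 ^ r * 2 ^ (k - r)" using assms(1) by (simp flip: power_add)
  have "k - r = Suc (k - Suc r)" using assms(1) by simp
  \<comment> \<open>Doubling turns the leading bit \<open>2 ^ r * 2 ^ (k - Suc r)\<close> into
    exactly \<open>2 ^ k\<close>: the comparison reads \<open>b\<close>, and the subtraction removes
    it.\<close>
  then have double: "2 * (?w' * 2 ^ (k - Suc r)) = (if b then 2 ^ k else 0) + w * 2 ^ (k - r)"
    by (simp add: k algebra_simps)
  have "w * 2 ^ (k - r) < 2 ^ k" using assms(2) by (simp add: k)
  then show "2 ^ k \<le> 2 * (?w' * 2 ^ (k - Suc r)) \<longleftrightarrow> b"
      "shift (2 ^ k) (?w' * 2 ^ (k - Suc r)) = w * 2 ^ (k - r)"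
    unfolding shift_def double by auto
  show "?w' < 2 ^ Suc r" using assms(2) by simp
qed

text \<open>A branch is not cut off after \<open>k\<close> choices. Once the bits of
  \<open>y < 2 ^ k\<close> are used up, \<open>z\<close> is 0 and all later choices fall on
  \<open>v\<close>. Every \<open>y\<close> thus yields a full vertex cover, and only its size
  decides about success.\<close>

definition greedy_step ::
    "nat \<Rightarrow> (nat \<Rightarrow> nat \<times> nat) \<Rightarrow> nat \<Rightarrow> nat \<times> nat set \<Rightarrow> nat \<times> nat set" where
  "greedy_step P e i zX = (let (z, X) = zX; (u, v) = e i in
     if u \<in> X \<or> v \<in> X then (z, X)
     else (shift P z, insert (if P \<le> 2 * z then u else v) X))"

definition greedy :: "nat \<Rightarrow> (nat \<Rightarrow> nat \<times> nat) \<Rightarrow> nat \<Rightarrow> nat \<Rightarrow> nat set" where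
  "greedy P e m y = snd (loop (greedy_step P e) m (y, {}))"

text \<open>The set only grows, so an edge covered when its turn comes stays covered. As loops count
  down, the edges already treated are those with index at least \<open>i\<close>.\<close>

lemma greedy_covers:
  assumes "i < m"
  shows "fst (e i) \<in> greedy P e m y \<or> snd (e i) \<in> greedy P e m y"
proof -
  have "\<forall>j<m. 0 \<le> j \<longrightarrow> fst (e j) \<in> greedy P e m y \<or> snd (e j) \<in> greedy P e m y"
    unfolding greedy_def
    by (rule loop_inv[where I = "\<lambda>i (zX :: nat \<times> nat set).
        \<forall>j<m. i \<le> j \<longrightarrow> fst (e j) \<in> snd zX \<or> snd (e j) \<in> snd zX"])
      (auto simp: greedy_step_def Let_def split_beta le_eq_less_or_eq Suc_le_eq)
  then show ?thesis using assms by blast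
qed

lemma greedy_subset:
  "greedy P e m y \<subseteq> (\<Union>i<m. {fst (e i), snd (e i)})"
  unfolding greedy_def
  by (rule loop_inv[where I = "\<lambda>i (zX :: nat \<times> nat set). snd zX \<subseteq> (\<Union>i<m. {fst (e i), snd (e i)})"])
    (auto simp: greedy_step_def Let_def split_beta)

text \<open>Each uncovered edge has an endpoint in \<open>C\<close>, and choosing it uses up an
  element of \<open>C - X\<close>; hence \<open>r = card (C - X)\<close> bits suffice. The number
  \<open>w\<close> is built backwards: the induction hypothesis supplies the later bits, and
  \<open>shift_prepend\<close> puts the current one in front.\<close>

lemma greedy_step_within_cover:
  assumes "finite C" "\<forall>i<m. fst (e i) \<in> C \<or> snd (e i) \<in> C" "X \<subseteq> C" "card (C - X) = r" "r \<le> k"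
  shows "\<exists>w<2 ^ r. snd (loop (greedy_step (2 ^ k) e) m (w * 2 ^ (k - r), X)) \<subseteq> C"
  using assms
proof (induction m arbitrary: X r)
  case 0
  then show ?case by (auto intro: exI[of _ 0])
next
  case (Suc m)
  obtain u v where uv: "e m = (u, v)" by fastforce
  show ?case
  proof (cases "u \<in> X \<or> v \<in> X")
    case True
    have "\<exists>w<2 ^ r. snd (loop (greedy_step (2 ^ k) e) m (w * 2 ^ (k - r), X)) \<subseteq> C"
      by (rule Suc.IH) (use Suc.prems in auto)
    moreover have "greedy_step (2 ^ k) e m (z, X) = (z, X)" for z
      using True uv by (simp add: greedy_step_def)
    ultimately show ?thesis by simp
  next
    case False
    \<comment> \<open>The edge meets \<open>C\<close> but not \<open>X\<close>, so this endpoint is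
      a new element of \<open>C\<close>.\<close>
    define x where "x = (if u \<in> C then u else v)"
    have x: "x \<in> C - X" using False Suc.prems(2) uv by (auto simp: x_def)
    then have "card (C - X) > 0" using Suc.prems(1) by (auto simp: card_gt_0_iff)
    then obtain r' where r': "r = Suc r'" using Suc.prems(4) by (cases r) auto
    have "C - insert x X = (C - X) - {x}" by auto
    then have "card (C - insert x X) = r'" using x Suc.prems(4) r' by simp
    then have "\<exists>w<2 ^ r'. snd (loop (greedy_step (2 ^ k) e) m (w * 2 ^ (k - r'), insert x X)) \<subseteq> C"
      by (intro Suc.IH) (use Suc.prems x r' in auto)
    then obtain w where w: "w < 2 ^ r'"
      "snd (loop (greedy_step (2 ^ k) e) m (w * 2 ^ (k - r'), insert x X)) \<subseteq> C" by blast
    have "r' < k" using r' Suc.prems(5) by simp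
    from shift_prepend[OF this w(1), of "u \<in> C"] obtain w' where w': "w' < 2 ^ Suc r'"
      "2 ^ k \<le> 2 * (w' * 2 ^ (k - Suc r')) \<longleftrightarrow> u \<in> C"
      "shift (2 ^ k) (w' * 2 ^ (k - Suc r')) = w * 2 ^ (k - r')" .
    have "greedy_step (2 ^ k) e m (w' * 2 ^ (k - r), X) = (w * 2 ^ (k - r'), insert x X)"
      using False uv w'(2,3) unfolding r' greedy_step_def x_def by simp
    then show ?thesis using w(2) w'(1) r' by (metis loop.simps(2))
  qed
qed

lemma greedy_within_cover:
  assumes "finite C" "\<forall>i<m. fst (e i) \<in> C \<or> snd (e i) \<in> C"
  obtains y where "y < 2 ^ card C" "greedy (2 ^ card C) e m y \<subseteq> C"
  using greedy_step_within_cover[OF assms, of "{}" "card C" "card C"]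
  by (auto simp: greedy_def)

text \<open>A set bit puts the vertex into the part \<open>D\<close> of \<open>X\<close> that is
  left out of the cover. Only vertices of \<open>X\<close> consume a bit.\<close>

definition select_step :: "nat \<Rightarrow> nat set \<Rightarrow> nat \<Rightarrow> nat \<times> nat set \<Rightarrow> nat \<times> nat set" where
  "select_step P X v zD = (let (z, D) = zD in
     if v \<in> X then (shift P z, if P \<le> 2 * z then insert v D else D) else (z, D))"

definition select :: "nat \<Rightarrow> nat set \<Rightarrow> nat \<Rightarrow> nat \<Rightarrow> nat set" where
  "select P X n y = snd (loop (select_step P X) n (y, {}))"

text \<open>The bits are membership in \<open>T\<close>, again prepended one by one;
  \<open>r\<close> counts the vertices of \<open>X\<close> still to be visited.\<close>

lemma select_step_surj:
  assumes "T \<subseteq> X" "T \<subseteq> {..<n}" "card (X \<inter> {..<n}) = r" "r \<le> k"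
  shows "\<exists>w<2 ^ r. snd (loop (select_step (2 ^ k) X) n (w * 2 ^ (k - r), D)) = D \<union> T"
  using assms
proof (induction n arbitrary: D T r)
  case 0
  then show ?case by (auto intro: exI[of _ 0])
next
  case (Suc n)
  let ?T = "T - {n}"
  have T: "?T \<subseteq> X" "?T \<subseteq> {..<n}" using Suc.prems by auto
  show ?case
  proof (cases "n \<in> X")
    case False
    then have "X \<inter> {..<Suc n} = X \<inter> {..<n}" "?T = T"
      using Suc.prems(1) by (auto simp: less_Suc_eq)
    moreover have "select_step (2 ^ k) X n (z, D) = (z, D)" for z
      using False by (simp add: select_step_def)
    ultimately show ?thesis using Suc.IH[OF T, of r D] Suc.prems by simp
  next
    case True
    then have "X \<inter> {..<Suc n} = insert n (X \<inter> {..<n})" by (auto simp: less_Suc_eq)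
    then obtain r' where r': "r = Suc r'" "card (X \<inter> {..<n}) = r'" using Suc.prems(3) by auto
    let ?D = "if n \<in> T then insert n D else D"
    obtain w where w: "w < 2 ^ r'"
      "snd (loop (select_step (2 ^ k) X) n (w * 2 ^ (k - r'), ?D)) = ?D \<union> ?T"
      using Suc.IH[OF T r'(2), of ?D] Suc.prems(4) r' by auto
    have "r' < k" using r' Suc.prems(4) by simp
    from shift_prepend[OF this w(1), of "n \<in> T"] obtain w' where w': "w' < 2 ^ Suc r'"
      "2 ^ k \<le> 2 * (w' * 2 ^ (k - Suc r')) \<longleftrightarrow> n \<in> T"
      "shift (2 ^ k) (w' * 2 ^ (k - Suc r')) = w * 2 ^ (k - r')" .
    have "select_step (2 ^ k) X n (w' * 2 ^ (k - r), D) = (w * 2 ^ (k - r'), ?D)"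
      using True w'(2,3) unfolding r' select_step_def by simp
    moreover have "?D \<union> ?T = D \<union> T" by auto
    ultimately show ?thesis using w w' r' by (metis loop.simps(2))
  qed
qed

lemma select_subset: "select P X n y \<subseteq> X"
  unfolding select_def
  by (rule loop_inv[where I = "\<lambda>i (zD :: nat \<times> nat set). snd zD \<subseteq> X"])
    (auto simp: select_step_def split_beta)

text \<open>Only surjectivity is shown directly. Both sides have \<open>2 ^ card X\<close> elements,
  so injectivity follows by counting.\<close>

lemma bij_betw_select:
  assumes "X \<subseteq> {..<n}"
  shows "bij_betw (select (2 ^ card X) X n) {..<2 ^ card X} (Pow X)"
proof -
  let ?f = "select (2 ^ card X) X n"
  have fin: "finite X" using assms finite_subset by blast
  have X: "X \<inter> {..<n} = X" using assms by auto
  have img: "?f ` {..<2 ^ card X} = Pow X"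
  proof
    show "Pow X \<subseteq> ?f ` {..<2 ^ card X}"
    proof
      fix T assume "T \<in> Pow X"
      then have "T \<subseteq> X" "T \<subseteq> {..<n}" using assms by auto
      from select_step_surj[OF this, of "card X" "card X" "{}"]
      show "T \<in> ?f ` {..<2 ^ card X}" by (auto simp: select_def X)
    qed
  qed (use select_subset in blast)
  moreover have "inj_on ?f {..<2 ^ card X}"
    by (rule eq_card_imp_inj_on) (simp_all add: img card_Pow fin)
  ultimately show ?thesis by (simp add: bij_betw_def)
qed

section \<open>Minimal vertex covers from a vertex cover\<close>

definition candidate :: "nat set set \<Rightarrow> nat set \<Rightarrow> nat set \<Rightarrow> nat set" where
  "candidate E X D = (X - D) \<union> {w. \<exists>v\<in>D. {v, w} \<in> E}"

text \<open>The first condition amounts to independence of \<open>D\<close>. The second is the local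
  form of minimality: deleting \<open>v\<close> would leave the edge to \<open>w\<close>
  uncovered.\<close>

definition accepted :: "nat set set \<Rightarrow> nat set \<Rightarrow> nat set \<Rightarrow> bool" where
  "accepted E X D \<longleftrightarrow> D \<inter> candidate E X D = {} \<and>
     (\<forall>v\<in>candidate E X D. \<exists>w. {v, w} \<in> E \<and> w \<notin> candidate E X D)"

lemma edgeE:
  assumes "simple_graph V E" "e \<in> E"
  obtains u v where "e = {u, v}" "u \<noteq> v" "u \<in> V" "v \<in> V"
  using assms unfolding simple_graph_def card_2_iff by fastforce

text \<open>An edge has an endpoint \<open>u\<close> in \<open>X\<close>. Either \<open>u\<close> is
  kept, or \<open>u\<close> lies in \<open>D\<close> and the other endpoint is a neighbour of
  \<open>D\<close>.\<close>

lemma candidate_cover: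
  assumes "simple_graph V E" "vertex_cover V E X"
  shows "vertex_cover V E (candidate E X D)"
  unfolding vertex_cover_def
proof
  show "candidate E X D \<subseteq> V"
    using assms by (auto simp: candidate_def vertex_cover_def simple_graph_def)
  show "\<forall>e\<in>E. e \<inter> candidate E X D \<noteq> {}"
  proof
    fix e assume "e \<in> E"
    with assms(2) obtain u where "u \<in> e" "u \<in> X" by (auto simp: vertex_cover_def)
    moreover obtain v where "e = {u, v}"
      using edgeE[OF assms(1) \<open>e \<in> E\<close>] \<open>u \<in> e\<close> by (metis empty_iff insert_commute insert_iff)
    ultimately show "e \<inter> candidate E X D \<noteq> {}" using \<open>e \<in> E\<close> by (auto simp: candidate_def)
  qed
qed

lemma accepted_minimal:
  assumes "simple_graph V E" "vertex_cover V E X" "accepted E X D"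
  shows "minimal_vertex_cover V E (candidate E X D)"
  unfolding minimal_vertex_cover_def
proof (intro conjI allI impI notI)
  fix C assume C: "C \<subset> candidate E X D" "vertex_cover V E C"
  then obtain v where v: "v \<in> candidate E X D" "v \<notin> C" by auto
  then obtain w where "{v, w} \<in> E" "w \<notin> candidate E X D"
    using assms(3) by (auto simp: accepted_def)
  then show False using C v by (auto simp: vertex_cover_def)
qed (rule candidate_cover[OF assms(1,2)])

text \<open>A cover that omits \<open>X - C\<close> must contain all its neighbours, so the
  candidate is a cover inside \<open>C\<close>, and minimality forces equality. For acceptance, an
  edge left uncovered by \<open>C - {v}\<close> has its other endpoint outside
  \<open>C\<close>.\<close>

lemma minimal_candidate:
  assumes "simple_graph V E" "vertex_cover V E X" "minimal_vertex_cover V E C"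
  shows "candidate E X (X - C) = C" "accepted E X (X - C)"
proof -
  have C: "vertex_cover V E C" using assms(3) by (simp add: minimal_vertex_cover_def)
  have "candidate E X (X - C) \<subseteq> C"
    using C by (auto simp: candidate_def vertex_cover_def)
  then show eq: "candidate E X (X - C) = C"
    using candidate_cover[OF assms(1,2)] assms(3) unfolding minimal_vertex_cover_def by blast
  have "\<exists>w. {v, w} \<in> E \<and> w \<notin> C" if "v \<in> C" for v
  proof -
    have "\<not> vertex_cover V E (C - {v})" using assms(3) that
      by (auto simp: minimal_vertex_cover_def)
    then obtain e where e: "e \<in> E" "e \<inter> (C - {v}) = {}"
      using C by (auto simp: vertex_cover_def)
    then have "v \<in> e" using C by (auto simp: vertex_cover_def)
    obtain w where "e = {v, w}" "w \<noteq> v"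
      using edgeE[OF assms(1) e(1)] \<open>v \<in> e\<close> by (metis empty_iff insert_commute insert_iff)
    then show ?thesis using e by auto
  qed
  then show "accepted E X (X - C)" unfolding accepted_def eq by blast
qed

text \<open>For an accepted \<open>D\<close> the candidate meets \<open>X\<close> exactly in
  \<open>X - D\<close>, so it determines \<open>D\<close>.\<close>

lemma inj_on_candidate: "inj_on (candidate E X) {D. D \<subseteq> X \<and> accepted E X D}"
proof (rule inj_onI)
  have "D = X - candidate E X D" if "D \<subseteq> X" "accepted E X D" for D
    using that by (auto simp: accepted_def candidate_def)
  then show "D = D'" if "D \<in> {D. D \<subseteq> X \<and> accepted E X D}"
    "D' \<in> {D. D \<subseteq> X \<and> accepted E X D}" "candidate E X D = candidate E X D'" for D D'
    using that by (metis (mono_tags, lifting) mem_Collect_eq)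
qed

lemma minimal_covers_eq:
  assumes "simple_graph V E" "vertex_cover V E X"
  shows "{C. minimal_vertex_cover V E C} = candidate E X ` {D. D \<subseteq> X \<and> accepted E X D}"
proof (intro equalityI subsetI)
  fix C assume "C \<in> {C. minimal_vertex_cover V E C}"
  then have "minimal_vertex_cover V E C" by simp
  from minimal_candidate[OF assms this]
  show "C \<in> candidate E X ` {D. D \<subseteq> X \<and> accepted E X D}"
    by (intro image_eqI[of _ _ "X - C"]) auto
qed (use accepted_minimal[OF assms] in auto)

lemma finite_covers: "simple_graph V E \<Longrightarrow> finite {C. vertex_cover V E C}"
  by (rule finite_subset[of _ "Pow V"]) (auto simp: vertex_cover_def simple_graph_def)

lemma vc_le: "simple_graph V E \<Longrightarrow> vertex_cover V E C \<Longrightarrow> vc V E \<le> card C"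
  unfolding vc_def by (rule Min_le) (auto simp: finite_covers)

lemma vertex_cover_vertices: "simple_graph V E \<Longrightarrow> vertex_cover V E V"
  by (auto simp: vertex_cover_def elim: edgeE)

lemma vc_attained:
  assumes "simple_graph V E"
  obtains C where "vertex_cover V E C" "card C = vc V E"
proof -
  have "vc V E \<in> card ` {C. vertex_cover V E C}"
    unfolding vc_def using vertex_cover_vertices[OF assms] finite_covers[OF assms]
    by (intro Min_in) auto
  then show ?thesis using that by auto
qed

text \<open>Makes \<open>X\<close> one of the minimal covers, so that \<open>card X\<close> can
  serve as the reference size for all of them.\<close>

lemma minimum_cover_minimal:
  assumes "simple_graph V E" "vertex_cover V E X" "card X = vc V E"
  shows "minimal_vertex_cover V E X"
  unfolding minimal_vertex_cover_def
proof (intro conjI allI impI notI)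
  fix D assume D: "D \<subset> X" "vertex_cover V E D"
  have "finite X" using assms by (auto simp: vertex_cover_def simple_graph_def intro: finite_subset)
  from psubset_card_mono[OF this D(1)] vc_le[OF assms(1) D(2)] assms(3) show False by simp
qed (rule assms(2))

section \<open>The programs\<close>

text \<open>Scalar variables and arrays. \<open>vP\<close> holds \<open>2 ^ k\<close> in round \<open>k\<close> of the search for \<open>X\<close>,
  and \<open>vQ\<close> holds \<open>2 ^ card X\<close>.\<close>

abbreviation (input) "vZero \<equiv> 0::nat"
abbreviation (input) "vOne \<equiv> 1::nat"
abbreviation (input) "vN \<equiv> 2::nat"
abbreviation (input) "vM \<equiv> 3::nat"
abbreviation (input) "vP \<equiv> 4::nat"
abbreviation (input) "vQ \<equiv> 5::nat"
abbreviation (input) "vSize \<equiv> 6::nat"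
abbreviation (input) "vFound \<equiv> 7::nat"
abbreviation (input) "vK \<equiv> 8::nat"
abbreviation (input) "vY \<equiv> 9::nat"
abbreviation (input) "vZ \<equiv> 10::nat"
abbreviation (input) "vV \<equiv> 11::nat"
abbreviation (input) "vI \<equiv> 12::nat"
abbreviation (input) "vU \<equiv> 13::nat"
abbreviation (input) "vW \<equiv> 14::nat"
abbreviation (input) "vA \<equiv> 15::nat"
abbreviation (input) "vB \<equiv> 16::nat"
abbreviation (input) "vT \<equiv> 17::nat"
abbreviation (input) "vOk \<equiv> 18::nat"
abbreviation (input) "vCnt \<equiv> 19::nat"
abbreviation (input) "vBad \<equiv> 20::nat"
abbreviation (input) "vN1 \<equiv> 21::nat"

abbreviation (input) "aU \<equiv> 0::nat"
abbreviation (input) "aV \<equiv> 1::nat"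
abbreviation (input) "aX \<equiv> 2::nat"
abbreviation (input) "aC \<equiv> 3::nat"
abbreviation (input) "aD \<equiv> 4::nat"
abbreviation (input) "aW \<equiv> 5::nat"

definition read_graph :: com where
  "read_graph = Const vOne 1 ;; Input vN ;; Input vM ;;
     For vI vM (Input vU ;; Input vW ;; Put aU vI vU ;; Put aV vI vW)"

text \<open>Only positivity can be tested. Adding two marks acts as a disjunction, and with
  truncated subtraction \<open>2 * z + 1 - P\<close> is positive iff
  \<open>P \<le> 2 * z\<close>.\<close>

definition greedy_edge :: com where
  "greedy_edge = Get vU aU vI ;; Get vW aV vI ;; Get vA aX vU ;; Get vB aX vW ;; Plus vA vA vB ;;
     Cond vA Skip
       (Plus vZ vZ vZ ;; Plus vQ vQ vQ ;; Plus vSize vSize vOne ;;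
        Plus vT vZ vOne ;; Minus vT vT vP ;;
        Cond vT (Minus vZ vZ vP ;; Put aX vU vOne) (Put aX vW vOne))"

text \<open>The budget is checked on powers: \<open>vQ\<close> doubles with every chosen vertex, so
  \<open>vQ \<le> vP\<close> says that at most \<open>k\<close> were taken. After success
  \<open>vQ\<close> is the number of subsets to run through.\<close>

definition try_greedy :: com where
  "try_greedy = For vV vN (Put aX vV vZero) ;;
     Plus vZ vY vZero ;; Const vQ 1 ;; Const vSize 0 ;; For vI vM greedy_edge ;;
     Minus vT vQ vP ;; Cond vT Skip (Const vFound 1)"

definition try_all :: com where
  "try_all = For vY vP (Cond vFound Skip try_greedy)"

text \<open>A bounded loop replaces an open-ended search: \<open>n + 1\<close> rounds are enough
  since \<open>vc\<close> is at most \<open>n\<close>, and once \<open>vFound\<close> is set the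
  remaining rounds take constant time each.\<close>

definition find_cover :: com where
  "find_cover = Const vP 1 ;; Const vFound 0 ;; Plus vN1 vN vOne ;;
     For vK vN1 (Cond vFound Skip (try_all ;; Cond vFound Skip (Plus vP vP vP)))"

definition select_vertex :: com where
  "select_vertex = Put aC vV vZero ;; Put aD vV vZero ;; Put aW vV vZero ;; Get vA aX vV ;;
     Cond vA
       (Plus vZ vZ vZ ;; Plus vT vZ vOne ;; Minus vT vT vQ ;;
        Cond vT (Minus vZ vZ vQ ;; Put aD vV vOne) (Put aC vV vOne))
       Skip"

definition add_neighbours :: com where
  "add_neighbours = Get vU aU vI ;; Get vW aV vI ;;
     Get vA aD vU ;; Cond vA (Put aC vW vOne) Skip ;;
     Get vA aD vW ;; Cond vA (Put aC vU vOne) Skip"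

text \<open>This needs a second pass over the edges, because \<open>aC\<close> is final only after
  all neighbours have been added. Marking from the edges finds all witnesses in linear time without
  adjacency lists.\<close>

definition mark_witnessed :: com where
  "mark_witnessed = Get vU aU vI ;; Get vW aV vI ;;
     Get vA aC vW ;; Cond vA Skip (Put aW vU vOne) ;;
     Get vA aC vU ;; Cond vA Skip (Put aW vW vOne)"

text \<open>The size is counted here because the output format puts it in front of the
  elements.\<close>

definition check_vertex :: com where
  "check_vertex = Get vA aC vV ;;
     Cond vA
       (Plus vCnt vCnt vOne ;;
        Get vA aW vV ;; Cond vA Skip (Const vOk 0) ;;
        Get vA aD vV ;; Cond vA (Const vOk 0) Skip)
       Skip"

definition test_subset :: com where
  "test_subset = Plus vZ vY vZero ;; For vV vN select_vertex ;; For vI vM add_neighbours ;;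
     For vI vM mark_witnessed ;; Const vOk 1 ;; Const vCnt 0 ;; For vV vN check_vertex"

definition print_cover :: com where
  "print_cover = Cond vOk (Output vCnt ;; For vV vN (Get vA aC vV ;; Cond vA (Output vV) Skip)) Skip"

definition compare_size :: com where
  "compare_size = Cond vOk
     (Minus vT vCnt vSize ;; Cond vT (Const vBad 1) Skip ;;
      Minus vT vSize vCnt ;; Cond vT (Const vBad 1) Skip) Skip"

definition enumerate_covers :: com where
  "enumerate_covers = read_graph ;; find_cover ;; For vY vQ (test_subset ;; print_cover)"

definition decide_well_covered :: com where
  "decide_well_covered = read_graph ;; find_cover ;; For vY vQ (test_subset ;; compare_size) ;;
     Minus vT vOne vBad ;; Output vT"

lemmas com_defs = read_graph_def greedy_edge_def try_greedy_def try_all_def find_cover_def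
  select_vertex_def add_neighbours_def mark_witnessed_def check_vertex_def test_subset_def
  print_cover_def compare_size_def enumerate_covers_def decide_well_covered_def

lemma well_formed_enumerate_covers: "well_formed 0 enumerate_covers"
  by (simp add: com_defs)

lemma well_formed_decide_well_covered: "well_formed 0 decide_well_covered"
  by (simp add: com_defs)

definition graph_state :: "nat \<Rightarrow> nat \<Rightarrow> (nat \<Rightarrow> nat \<times> nat) \<Rightarrow> state \<Rightarrow> bool" where
  "graph_state n m e s \<longleftrightarrow> vr s vZero = 0 \<and> vr s vOne = 1 \<and> vr s vN = n \<and> vr s vM = m \<and>
     (\<forall>i<m. ar s aU i = fst (e i) \<and> ar s aV i = snd (e i))"

definition stores :: "state \<Rightarrow> nat \<Rightarrow> nat \<Rightarrow> nat set \<Rightarrow> bool" where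
  "stores s a n S \<longleftrightarrow> (\<forall>v<n. ar s a v > 0 \<longleftrightarrow> v \<in> S)"

lemma graph_state_frame:
  assumes "graph_state n m e s" "writes c \<inter> {vZero, vOne, vN, vM} = {}"
    "array_writes c \<inter> {aU, aV} = {}"
  shows "graph_state n m e (sem c s)"
proof -
  have "vZero \<notin> writes c" "vOne \<notin> writes c" "vN \<notin> writes c" "vM \<notin> writes c"
    "aU \<notin> array_writes c" "aV \<notin> array_writes c" using assms(2,3) by auto
  then show ?thesis using assms(1) by (simp add: graph_state_def vr_frame ar_frame)
qed

lemma graph_state_setv [simp]:
  "x > 3 \<Longrightarrow> graph_state n m e (setv x k s) \<longleftrightarrow> graph_state n m e s"
  by (simp add: graph_state_def)

lemma stores_frame: "stores s a n S \<Longrightarrow> a \<notin> array_writes c \<Longrightarrow> stores (sem c s) a n S"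
  by (simp add: stores_def ar_frame)

lemma stores_setv [simp]: "stores (setv x k s) a n S \<longleftrightarrow> stores s a n S"
  by (simp add: stores_def)

text \<open>The index list is reversed because loops count down.\<close>

lemma read_graph_correct:
  assumes "length es = m"
  shows "graph_state n m (\<lambda>i. rev es ! i)
    (sem read_graph (init (n # m # concat (map (\<lambda>(u, v). [u, v]) es))))"
    (is "graph_state n m ?e (sem _ ?s)")
proof -
  let ?c = "Input vU ;; Input vW ;; Put aU vI vU ;; Put aV vI vW"
  let ?rd = "sem (Input vM) (sem (Input vN) (sem (Const vOne 1) ?s))"
  \<comment> \<open>The unread input consists of the edges with index below \<open>i\<close>,
    highest index first.\<close>
  define I where "I i s \<longleftrightarrow> vr s vZero = 0 \<and> vr s vOne = 1 \<and> vr s vN = n \<and> vr s vM = m \<and>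
     sin s = concat (map (\<lambda>(u, v). [u, v]) (rev (take i (rev es)))) \<and>
     (\<forall>j. i \<le> j \<longrightarrow> j < m \<longrightarrow> ar s aU j = fst (?e j) \<and> ar s aV j = snd (?e j))" for i and s :: state
  have "I 0 (loop (\<lambda>i s. sem ?c (setv vI i s)) m ?rd)"
  proof (rule loop_inv[where I = I])
    show "I m ?rd" using assms by (simp add: I_def init_def)
    fix i s assume i: "i < m" and I: "I (Suc i) s"
    obtain u v where uv: "?e i = (u, v)" by fastforce
    have "rev (take (Suc i) (rev es)) = (u, v) # rev (take i (rev es))"
      using i assms uv by (simp add: take_Suc_conv_app_nth)
    then show "I i (sem ?c (setv vI i s))"
      using I uv by (auto simp: I_def Suc_le_eq)
  qed
  moreover have "vr ?rd vM = m" by (simp add: init_def)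
  ultimately show ?thesis by (simp add: read_graph_def I_def graph_state_def)
qed

lemma greedy_edge_correct:
  assumes "graph_state n m e s" "i < m" "fst (e i) < n" "snd (e i) < n" "fst (e i) \<noteq> snd (e i)"
    "finite X" "stores s aX n X" "vr s vQ = 2 ^ card X" "vr s vSize = card X"
    "greedy_step (vr s vP) e i (vr s vZ, X) = (z', X')" "s' = sem greedy_edge (setv vI i s)"
  shows "finite X'" "stores s' aX n X'" "vr s' vQ = 2 ^ card X'" "vr s' vSize = card X'"
    "vr s' vZ = z'"
proof -
  obtain u v where uv: "e i = (u, v)" by fastforce
  have X: "ar s aX u > 0 \<longleftrightarrow> u \<in> X" "ar s aX v > 0 \<longleftrightarrow> v \<in> X"
    using assms(3,4,7) uv by (auto simp: stores_def)
  have "finite X' \<and> stores s' aX n X' \<and> vr s' vQ = 2 ^ card X' \<and> vr s' vSize = card X' \<and> vr s' vZ = z'"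
    using assms uv X
    by (auto simp: greedy_edge_def greedy_step_def graph_state_def stores_def shift_def split: if_splits)
  then show "finite X'" "stores s' aX n X'" "vr s' vQ = 2 ^ card X'" "vr s' vSize = card X'"
    "vr s' vZ = z'" by auto
qed

section \<open>Correctness and cost of the programs\<close>

lemma le_power_2_mult: "(a::nat) \<le> 2 ^ k * a"
  by simp

lemma subsets_eq_select:
  assumes "X \<subseteq> {..<n}"
  shows "{D. D \<subseteq> X \<and> p D} =
    select (2 ^ card X) X n ` {y. y < 2 ^ card X \<and> p (select (2 ^ card X) X n y)}"
proof -
  have "D \<subseteq> X \<longleftrightarrow> D \<in> select (2 ^ card X) X n ` {..<2 ^ card X}" for D
    using bij_betw_select[OF assms] by (simp add: bij_betw_def)
  then show ?thesis by auto
qed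

locale indexed_graph =
  fixes n m :: nat and e :: "nat \<Rightarrow> nat \<times> nat"
  assumes endpoints: "i < m \<Longrightarrow> fst (e i) < n \<and> snd (e i) < n \<and> fst (e i) \<noteq> snd (e i)"
begin

abbreviation V :: "nat set" where
  "V \<equiv> {..<n}"

abbreviation E :: "nat set set" where
  "E \<equiv> (\<lambda>i. {fst (e i), snd (e i)}) ` {..<m}"

lemma graph: "simple_graph V E"
  using endpoints by (auto simp: simple_graph_def)

lemma greedy_vertex_cover: "vertex_cover V E (greedy P e m y)"
  using greedy_subset[of P e m y] greedy_covers[of _ m e P y] endpoints
  by (fastforce simp: vertex_cover_def)

section \<open>Finding a minimum vertex cover\<close>

lemma try_greedy_correct:
  assumes s: "graph_state n m e s" "vr s vFound = 0" and s': "s' = sem try_greedy s"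
    and X: "X = greedy (vr s vP) e m (vr s vY)"
  shows "stores s' aX n X" "vr s' vQ = 2 ^ card X" "vr s' vSize = card X"
    "vr s' vFound = (if 2 ^ card X \<le> vr s vP then 1 else 0)"
proof -
  define s1 where "s1 = sem (For vV vN (Put aX vV vZero)) s"
  define s2 where "s2 = sem (Const vSize 0) (sem (Const vQ 1) (sem (Plus vZ vY vZero) s1))"
  define s3 where "s3 = sem (For vI vM greedy_edge) s2"
  have "\<forall>v. 0 \<le> v \<longrightarrow> v < n \<longrightarrow> ar s1 aX v = 0"
  proof -
    have "(\<lambda>i s. vr s vZero = 0 \<and> (\<forall>v. i \<le> v \<longrightarrow> v < n \<longrightarrow> ar s aX v = 0)) 0 s1"
      unfolding s1_def sem.simps(11)
      by (rule loop_inv) (use s(1) in \<open>auto simp: graph_state_def Suc_le_eq\<close>)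
    then show ?thesis by simp
  qed
  moreover have "graph_state n m e s1"
    unfolding s1_def by (rule graph_state_frame[OF s(1)]) auto
  moreover have "vr s1 x = vr s x" if "x \<noteq> vV" for x
    unfolding s1_def by (rule vr_frame) (use that in simp)
  then have fr1: "vr s1 vY = vr s vY" "vr s1 vP = vr s vP" "vr s1 vFound = 0"
    using s(2) by simp_all
  ultimately have s2: "graph_state n m e s2" "stores s2 aX n {}" "vr s2 vQ = 1" "vr s2 vSize = 0"
    "vr s2 vZ = vr s vY" "vr s2 vP = vr s vP"
    by (simp_all add: s2_def graph_state_def stores_def)
  define R where "R s' zX \<longleftrightarrow> graph_state n m e s' \<and> vr s' vP = vr s vP \<and> vr s' vZ = fst zX \<and>
     finite (snd zX) \<and> stores s' aX n (snd zX) \<and> vr s' vQ = 2 ^ card (snd zX) \<and>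
     vr s' vSize = card (snd zX)" for s' and zX :: "nat \<times> nat set"
  have "R s3 (loop (greedy_step (vr s vP) e) m (vr s vY, {}))"
  proof -
    have m: "vr s2 vM = m" using s2(1) by (simp add: graph_state_def)
    show ?thesis unfolding s3_def sem.simps(11) m
    proof (rule loop_sim[where R = "\<lambda>i. R"])
      show "R s2 (vr s vY, {})" using s2 by (simp add: R_def)
      fix i t and zX :: "nat \<times> nat set" assume i: "i < m" and R: "R t zX"
      obtain z X where zX: "zX = (z, X)" by fastforce
      obtain z' X' where zX': "greedy_step (vr s vP) e i zX = (z', X')" by fastforce
      let ?t = "sem greedy_edge (setv vI i t)"
      have *: "graph_state n m e t" "finite X" "stores t aX n X" "vr t vQ = 2 ^ card X"
        "vr t vSize = card X" "greedy_step (vr t vP) e i (vr t vZ, X) = (z', X')"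
        using R zX zX' by (auto simp: R_def)
      note ge = greedy_edge_correct[OF *(1) i _ _ _ *(2-6) refl]
      have "vr ?t vP = vr t vP" by (subst vr_frame) (auto simp: greedy_edge_def)
      moreover have "graph_state n m e ?t"
        using *(1) by (intro graph_state_frame) (auto simp: greedy_edge_def)
      ultimately show "R ?t (greedy_step (vr s vP) e i zX)"
        using ge endpoints[OF i] R unfolding zX' R_def by simp
    qed
  qed
  then have s3: "vr s3 vP = vr s vP" "stores s3 aX n X" "vr s3 vQ = 2 ^ card X" "vr s3 vSize = card X"
    by (auto simp: R_def X greedy_def)
  have "vr s3 vFound = vr s2 vFound" unfolding s3_def
    by (rule vr_frame) (simp add: greedy_edge_def)
  also have "\<dots> = 0" using fr1 by (simp add: s2_def)
  finally have "vr s3 vFound = 0" .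
  moreover have "s' = sem (Cond vT Skip (Const vFound 1)) (sem (Minus vT vQ vP) s3)"
    unfolding s' try_greedy_def s3_def s2_def s1_def by (simp only: sem.simps)
  ultimately show "stores s' aX n X" "vr s' vQ = 2 ^ card X" "vr s' vSize = card X"
    "vr s' vFound = (if 2 ^ card X \<le> vr s vP then 1 else 0)"
    using s3 by (auto simp: stores_def)
qed

text \<open>The bound is a parameter instead of the register \<open>vP\<close>, so that a cover
  found in an earlier round can be carried along with the fixed bound
  \<open>2 ^ vc V E\<close>.\<close>

definition cover_found :: "nat \<Rightarrow> state \<Rightarrow> bool" where
  "cover_found P s \<longleftrightarrow> (\<exists>X. vertex_cover V E X \<and> stores s aX n X \<and> vr s vQ = 2 ^ card X \<and>
     vr s vSize = card X \<and> 2 ^ card X \<le> P)"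

lemma cover_found_setv: "x \<noteq> vQ \<Longrightarrow> x \<noteq> vSize \<Longrightarrow> cover_found P (setv x k s) \<longleftrightarrow> cover_found P s"
  by (simp add: cover_found_def)

lemma try_all_correct:
  assumes s: "graph_state n m e s" "vr s vFound = 0" "vr s vP = P"
  shows "if vr (sem try_all s) vFound = 0 then \<forall>y<P. P < 2 ^ card (greedy P e m y)
    else cover_found P (sem try_all s)"
proof -
  let ?c = "Cond vFound Skip try_greedy"
  define I where "I i s \<longleftrightarrow> graph_state n m e s \<and> vr s vP = P \<and>
    (if vr s vFound = 0 then \<forall>y<P. i \<le> y \<longrightarrow> P < 2 ^ card (greedy P e m y)
     else cover_found P s)" for i s
  have "I 0 (loop (\<lambda>i s. sem ?c (setv vY i s)) P s)"
  proof (rule loop_inv[where I = I])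
    show "I P s" using s by (simp add: I_def)
    fix i s assume i: "i < P" and I: "I (Suc i) s"
    show "I i (sem ?c (setv vY i s))"
    proof (cases "vr s vFound = 0")
      case False
      then show ?thesis using I by (simp add: I_def cover_found_setv)
    next
      case True
      let ?s = "setv vY i s"
      let ?X = "greedy P e m i"
      have "graph_state n m e ?s" "vr ?s vFound = 0" "vr ?s vP = P" "vr ?s vY = i"
        using I True by (simp_all add: I_def)
      note t = try_greedy_correct[OF this(1,2) refl refl, unfolded this(3,4)]
      have "vP \<notin> writes try_greedy" by (simp add: com_defs)
      then have "vr (sem try_greedy ?s) vP = P" using I by (simp add: I_def vr_frame)
      moreover have "graph_state n m e (sem try_greedy ?s)"
        by (rule graph_state_frame) (use I in \<open>auto simp: I_def com_defs\<close>)
      moreover have "\<forall>y<P. i \<le> y \<longrightarrow> P < 2 ^ card (greedy P e m y)" if "\<not> 2 ^ card ?X \<le> P"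
        using I True that by (auto simp: I_def Suc_le_eq le_less)
      moreover have "cover_found P (sem try_greedy ?s)" if "2 ^ card ?X \<le> P"
        unfolding cover_found_def using t greedy_vertex_cover that by blast
      ultimately have "I i (sem try_greedy ?s)" using t(4) by (simp add: I_def)
      then show ?thesis using True by simp
    qed
  qed
  then show ?thesis using s(3) by (simp add: I_def try_all_def)
qed

text \<open>One branch has the static bound \<open>18 + 9 * n + 50 * m\<close>; 150 is a generous
  rounding.\<close>

lemma cost_try_all:
  assumes "graph_state n m e s"
  shows "cost try_all s \<le> 3 + vr s vP * (150 * (n + m + 1))"
proof -
  let ?\<sigma> = "(\<lambda>_. 0)(vN := n, vM := m, vP := vr s vP)"
  have "cost try_all s \<le> cost_bound try_all ?\<sigma>"
    by (rule cost_le_bound) (use assms in \<open>auto simp: com_defs graph_state_def\<close>)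
  also have "\<dots> \<le> 3 + vr s vP * (150 * (n + m + 1))"
    by (simp add: com_defs)
  finally show ?thesis .
qed

lemma find_cover_correct:
  assumes s: "graph_state n m e s" and s': "s' = sem find_cover s"
  obtains X where "vertex_cover V E X" "card X = vc V E" "stores s' aX n X"
    "vr s' vQ = 2 ^ card X" "vr s' vSize = card X"
    "cost find_cover s \<le> 20 + 2 * 2 ^ vc V E * (150 * (n + m + 1)) + 20 * (n + 1)"
proof -
  define B where "B = 150 * (n + m + 1)"
  let ?k = "vc V E"
  define c where "c = Cond vFound Skip (try_all ;; Cond vFound Skip (Plus vP vP vP))"
  define s1 where "s1 = sem (Plus vN1 vN vOne) (sem (Const vFound 0) (sem (Const vP 1) s))"
  \<comment> \<open>\<open>n + 1 - i\<close> rounds are done and \<open>B\<close> bounds one branch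
    up to a constant per round. Failed rounds sum to at most \<open>2 ^ (n + 1 - i) * B\<close>, the
    successful one adds at most \<open>2 ^ ?k * B\<close>, and 20 per round pays for the
    overhead.\<close>
  define I where "I i s t \<longleftrightarrow> graph_state n m e s \<and>
    (if vr s vFound = 0
     then vr s vP = 2 ^ (n + 1 - i) \<and> n + 1 - i \<le> ?k \<and> t \<le> 2 ^ (n + 1 - i) * B + 20 * (n + 1 - i)
     else cover_found (2 ^ ?k) s \<and> t \<le> 2 * 2 ^ ?k * B + 20 * (n + 1 - i))" for i s t
  let ?f = "\<lambda>i s. sem c (setv vK i s)" and ?g = "\<lambda>i s. 3 + cost c (setv vK i s)"
  have "I 0 (loop ?f (n + 1) s1) (0 + loop_cost ?f ?g (n + 1) s1)"
  proof (rule loop_cost_inv[where I = I])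
    show "I (n + 1) s1 0" using s by (simp add: I_def s1_def graph_state_def)
    fix i s t assume i: "i < n + 1" and I: "I (Suc i) s t"
    define k where "k = n - i"
    have k: "n + 1 - Suc i = k" "n + 1 - i = Suc k" using i by (auto simp: k_def)
    show "I i (?f i s) (t + ?g i s)"
    proof (cases "vr s vFound = 0")
      case False
      then show ?thesis using I k by (auto simp: I_def c_def cover_found_setv)
    next
      case True
      let ?s = "setv vK i s"
      let ?t = "sem try_all ?s"
      have s: "graph_state n m e ?s" "vr ?s vFound = 0" "vr ?s vP = 2 ^ k"
        and kle: "k \<le> ?k" and t: "t \<le> 2 ^ k * B + 20 * k"
        using I True k by (simp_all add: I_def)
      have c: "cost try_all ?s \<le> 3 + 2 ^ k * B"
        using cost_try_all[OF s(1)] s(3) by (simp add: B_def)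
      have "vP \<notin> writes try_all" by (simp add: com_defs)
      then have P: "vr ?t vP = 2 ^ k" using s(3) by (simp add: vr_frame)
      have gs: "graph_state n m e ?t"
        by (rule graph_state_frame[OF s(1)]) (auto simp: com_defs)
      have le: "(2::nat) ^ k \<le> 2 ^ ?k" using kle by simp
      then have leB: "2 ^ k * B \<le> 2 ^ ?k * B" by simp
      note all = try_all_correct[OF s]
      show ?thesis
      proof (cases "vr ?t vFound = 0")
        case False
        then have "cover_found (2 ^ k) ?t" using all by simp
        then have "cover_found (2 ^ ?k) ?t" using le unfolding cover_found_def by (meson le_trans)
        moreover have "t + cost try_all ?s \<le> 14 + (2 * 2 ^ ?k * B + 20 * k)"
          using c t leB by linarith
        ultimately show ?thesis using False True gs k by (simp add: I_def c_def)
      next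
        case notfound: True
        \<comment> \<open>Round \<open>?k\<close> cannot fail: some branch stays inside a minimum
          cover and hence within the budget.\<close>
        have "k \<noteq> ?k"
        proof
          assume eq: "k = ?k"
          obtain C where C: "vertex_cover V E C" "card C = ?k" using vc_attained[OF graph] .
          have fin: "finite C" using C(1) by (auto simp: vertex_cover_def intro: finite_subset)
          have "\<forall>i<m. fst (e i) \<in> C \<or> snd (e i) \<in> C" using C(1) by (auto simp: vertex_cover_def)
          from greedy_within_cover[OF fin this] obtain y
            where y: "y < 2 ^ k" "greedy (2 ^ k) e m y \<subseteq> C" using C(2) eq by auto
          have "2 ^ k < (2::nat) ^ card (greedy (2 ^ k) e m y)" using all notfound y(1) by simp
          moreover have "card (greedy (2 ^ k) e m y) \<le> k"
            using card_mono[OF fin y(2)] C(2) eq by simp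
          ultimately show False by simp
        qed
        then show ?thesis using True notfound gs k c t P kle by (simp add: I_def c_def)
      qed
    qed
  qed
  moreover have "vr s1 vN1 = n + 1" using s by (simp add: s1_def graph_state_def)
  then have loop: "s' = loop ?f (n + 1) s1" "cost find_cover s = 6 + loop_cost ?f ?g (n + 1) s1"
    unfolding s' find_cover_def sem.simps cost.simps c_def[symmetric] s1_def by simp_all
  ultimately have I: "I 0 s' (cost find_cover s - 6)" by (simp only: loop add_diff_cancel_left' add_0)
  have "?k \<le> n" using vc_le[OF graph vertex_cover_vertices[OF graph]] by simp
  \<comment> \<open>Failure in all rounds would give \<open>n + 1 \<le> ?k\<close> by the
    invariant.\<close>
  then have "vr s' vFound \<noteq> 0" using I by (auto simp: I_def split: if_splits)
  then have "cover_found (2 ^ ?k) s'" and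
    cost: "cost find_cover s \<le> 20 + 2 * 2 ^ ?k * B + 20 * (n + 1)"
    using I by (auto simp: I_def)
  then obtain X where X: "vertex_cover V E X" "stores s' aX n X" "vr s' vQ = 2 ^ card X"
    "vr s' vSize = card X" "(2::nat) ^ card X \<le> 2 ^ ?k" by (auto simp: cover_found_def)
  then have "card X \<le> ?k" by simp
  with vc_le[OF graph X(1)] have "card X = ?k" by simp
  then show ?thesis using that X cost unfolding B_def by blast
qed

section \<open>Testing one subset in linear time\<close>

lemma edge_iff: "{v, w} \<in> E \<longleftrightarrow> (\<exists>i<m. e i = (v, w) \<or> e i = (w, v))"
  by (auto simp: image_iff doubleton_eq_iff prod_eq_iff)

text \<open>The adjacency relation of the edges already treated by a loop that has counted down to
  \<open>i\<close>; it is symmetric because edges are stored in an arbitrary orientation.\<close>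

definition edge_from :: "nat \<Rightarrow> nat \<Rightarrow> nat \<Rightarrow> bool" where
  "edge_from i v w \<longleftrightarrow> (\<exists>j<m. i \<le> j \<and> (e j = (v, w) \<or> e j = (w, v)))"

lemma edge_from_simps:
  "edge_from 0 v w \<longleftrightarrow> {v, w} \<in> E" "\<not> edge_from m v w"
  by (auto simp: edge_from_def edge_iff)

lemma edge_from_rec:
  assumes "i < m" "e i = (a, b)"
  shows "edge_from i v w \<longleftrightarrow> edge_from (Suc i) v w \<or> v = a \<and> w = b \<or> v = b \<and> w = a"
proof
  assume "edge_from i v w"
  then obtain j where j: "j < m" "i \<le> j" "e j = (v, w) \<or> e j = (w, v)"
    by (auto simp: edge_from_def)
  then show "edge_from (Suc i) v w \<or> v = a \<and> w = b \<or> v = b \<and> w = a"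
    using assms(2) by (cases "i = j") (auto simp: edge_from_def Suc_le_eq)
qed (use assms in \<open>auto simp: edge_from_def\<close>)

lemma select_vertices:
  assumes s: "graph_state n m e s" "stores s aX n X" and s': "s' = sem (For vV vN select_vertex) s"
    and D: "D = select (vr s vQ) X n (vr s vZ)"
  shows "stores s' aC n (X - D)" "stores s' aD n D" "stores s' aW n {}"
proof -
  \<comment> \<open>The inclusion in \<open>{i..<n}\<close> shows that the next vertex is not yet in
    the selected set, so the marks written at its turn are its final ones.\<close>
  define R where "R i s' zD \<longleftrightarrow> graph_state n m e s' \<and> stores s' aX n X \<and> vr s' vQ = vr s vQ \<and>
     vr s' vZ = fst zD \<and> snd zD \<subseteq> {i..<n} \<and>
     (\<forall>v<n. i \<le> v \<longrightarrow> (ar s' aC v > 0 \<longleftrightarrow> v \<in> X - snd zD) \<and> (ar s' aD v > 0 \<longleftrightarrow> v \<in> snd zD) \<and>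
        ar s' aW v = 0)" for i s' and zD :: "nat \<times> nat set"
  have "R 0 s' (loop (select_step (vr s vQ) X) n (vr s vZ, {}))"
  proof -
    have n: "vr s vN = n" using s(1) by (simp add: graph_state_def)
    show ?thesis unfolding s' sem.simps(11) n
    proof (rule loop_sim[where R = R])
      show "R n s (vr s vZ, {})" using s by (simp add: R_def)
      fix i t and zD :: "nat \<times> nat set" assume i: "i < n" and R: "R (Suc i) t zD"
      obtain z D where zD: "zD = (z, D)" by fastforce
      let ?t = "sem select_vertex (setv vV i t)"
      have "graph_state n m e (setv vV i t)" using R by (simp add: R_def)
      then have "graph_state n m e ?t"
        by (rule graph_state_frame) (auto simp: select_vertex_def)
      moreover have "stores ?t aX n X"
        by (rule stores_frame) (use R in \<open>auto simp: R_def select_vertex_def\<close>)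
      moreover have "vQ \<notin> writes select_vertex" by (simp add: select_vertex_def)
      then have "vr ?t vQ = vr s vQ" using R by (simp add: vr_frame R_def)
      moreover have "ar t aX i > 0 \<longleftrightarrow> i \<in> X" "vr t 0 = 0" "vr t (Suc 0) = 1"
        "vr t vZ = z" "vr t vQ = vr s vQ" and sub: "D \<subseteq> {Suc i..<n}"
        using R i zD by (auto simp: R_def stores_def graph_state_def)
      moreover from sub have "i \<notin> D" "D \<subseteq> {i..<n}" by auto
      moreover have "(ar t aC v > 0 \<longleftrightarrow> v \<in> X - D) \<and> (ar t aD v > 0 \<longleftrightarrow> v \<in> D) \<and> ar t aW v = 0"
        if "v < n" "i \<le> v" "v \<noteq> i" for v
        using R that zD by (simp add: R_def)
      ultimately show "R i ?t (select_step (vr s vQ) X i zD)"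
        unfolding R_def zD using i
        by (cases "i \<in> X"; cases "vr s vQ \<le> 2 * z")
          (simp_all add: select_vertex_def select_step_def shift_def)
    qed
  qed
  then show "stores s' aC n (X - D)" "stores s' aD n D" "stores s' aW n {}"
    by (auto simp: R_def stores_def D select_def)
qed

lemma add_all_neighbours:
  assumes s: "graph_state n m e s" "stores s aC n C" "stores s aD n D"
    and s': "s' = sem (For vI vM add_neighbours) s"
  shows "stores s' aC n (C \<union> {w. \<exists>v\<in>D. {v, w} \<in> E})"
proof -
  let ?N = "\<lambda>i. {w. \<exists>v\<in>D. edge_from i v w}"
  define I where "I i s \<longleftrightarrow> graph_state n m e s \<and> stores s aD n D \<and> stores s aC n (C \<union> ?N i)" for i s
  have m: "vr s vM = m" using s(1) by (simp add: graph_state_def)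
  have "I 0 s'" unfolding s' sem.simps(11) m
  proof (rule loop_inv[where I = I])
    have "?N m = {}" by (simp add: edge_from_simps)
    then show "I m s" using s by (simp only: I_def Un_empty_right)
    fix i t assume i: "i < m" and I: "I (Suc i) t"
    let ?t = "sem add_neighbours (setv vI i t)"
    obtain a b where ab: "e i = (a, b)" by fastforce
    have "graph_state n m e (setv vI i t)" using I by (simp add: I_def)
    then have gs: "graph_state n m e ?t"
      by (rule graph_state_frame) (auto simp: add_neighbours_def)
    have D: "stores ?t aD n D"
      by (rule stores_frame) (use I in \<open>auto simp: I_def add_neighbours_def\<close>)
    have "ar t aU i = a" "ar t aV i = b" "vr t (Suc 0) = 1" "a < n" "b < n"
      "ar t aD a > 0 \<longleftrightarrow> a \<in> D" "ar t aD b > 0 \<longleftrightarrow> b \<in> D"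
      using I i ab endpoints[OF i] by (auto simp: I_def graph_state_def stores_def)
    then have put: "stores ?t aC n (S \<union> (if a \<in> D then {b} else {}) \<union> (if b \<in> D then {a} else {}))"
      if "stores t aC n S" for S
      using that by (simp add: add_neighbours_def stores_def) auto
    have N: "?N i = ?N (Suc i) \<union> (if a \<in> D then {b} else {}) \<union> (if b \<in> D then {a} else {})"
      using edge_from_rec[OF i ab] by auto
    have "stores t aC n (C \<union> ?N (Suc i))" using I by (simp add: I_def)
    from put[OF this] have "stores ?t aC n (C \<union> ?N i)" unfolding N by (simp only: Un_assoc)
    with gs D show "I i ?t" by (simp add: I_def)
  qed
  then show ?thesis by (simp add: I_def edge_from_simps)
qed

lemma mark_all_witnessed:
  assumes s: "graph_state n m e s" "stores s aC n C" "stores s aW n {}"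
    and s': "s' = sem (For vI vM mark_witnessed) s"
  shows "stores s' aW n {v. \<exists>w. {v, w} \<in> E \<and> w \<notin> C}"
proof -
  let ?N = "\<lambda>i. {v. \<exists>w. edge_from i v w \<and> w \<notin> C}"
  define I where "I i s \<longleftrightarrow> graph_state n m e s \<and> stores s aC n C \<and> stores s aW n (?N i)" for i s
  have m: "vr s vM = m" using s(1) by (simp add: graph_state_def)
  have "I 0 s'" unfolding s' sem.simps(11) m
  proof (rule loop_inv[where I = I])
    have "?N m = {}" by (simp add: edge_from_simps)
    then show "I m s" using s by (simp only: I_def Un_empty_right)
    fix i t assume i: "i < m" and I: "I (Suc i) t"
    let ?t = "sem mark_witnessed (setv vI i t)"
    obtain a b where ab: "e i = (a, b)" by fastforce
    have "graph_state n m e (setv vI i t)" using I by (simp add: I_def)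
    then have gs: "graph_state n m e ?t"
      by (rule graph_state_frame) (auto simp: mark_witnessed_def)
    have C: "stores ?t aC n C"
      by (rule stores_frame) (use I in \<open>auto simp: I_def mark_witnessed_def\<close>)
    have "ar t aU i = a" "ar t aV i = b" "vr t (Suc 0) = 1" "a < n" "b < n"
      "ar t aC a > 0 \<longleftrightarrow> a \<in> C" "ar t aC b > 0 \<longleftrightarrow> b \<in> C"
      using I i ab endpoints[OF i] by (auto simp: I_def graph_state_def stores_def)
    then have put: "stores ?t aW n (S \<union> (if a \<in> C then {} else {b}) \<union> (if b \<in> C then {} else {a}))"
      if "stores t aW n S" for S
      using that by (simp add: mark_witnessed_def stores_def) auto
    have N: "?N i = ?N (Suc i) \<union> (if a \<in> C then {} else {b}) \<union> (if b \<in> C then {} else {a})"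
      using edge_from_rec[OF i ab] by auto
    have "stores t aW n (?N (Suc i))" using I by (simp add: I_def)
    from put[OF this] have "stores ?t aW n (?N i)" unfolding N .
    with gs C show "I i ?t" by (simp add: I_def)
  qed
  then show ?thesis by (simp add: I_def edge_from_simps)
qed

lemma check_vertices:
  assumes s: "graph_state n m e s" "stores s aC n C" "stores s aD n D" "stores s aW n W"
    "C \<subseteq> V" "vr s vOk = 1" "vr s vCnt = 0"
    and s': "s' = sem (For vV vN check_vertex) s"
  shows "vr s' vCnt = card C" "vr s' vOk > 0 \<longleftrightarrow> D \<inter> C = {} \<and> C \<subseteq> W"
proof -
  define I where "I i s \<longleftrightarrow> stores s aC n C \<and> stores s aD n D \<and> stores s aW n W \<and>
     vr s vOne = 1 \<and> vr s vCnt = card (C \<inter> {i..}) \<and>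
     (vr s vOk > 0 \<longleftrightarrow> (\<forall>v\<in>C. i \<le> v \<longrightarrow> v \<notin> D \<and> v \<in> W))" for i s
  have n: "vr s vN = n" using s(1) by (simp add: graph_state_def)
  have fin: "finite C" using s(5) finite_subset by blast
  have "I 0 s'" unfolding s' sem.simps(11) n
  proof (rule loop_inv[where I = I])
    have "C \<inter> {n..} = {}" "\<forall>v\<in>C. \<not> n \<le> v" using s(5) by auto
    then show "I n s" using s by (simp add: I_def graph_state_def)
    fix i t assume i: "i < n" and I: "I (Suc i) t"
    have ab: "ar t aC i > 0 \<longleftrightarrow> i \<in> C" "ar t aD i > 0 \<longleftrightarrow> i \<in> D" "ar t aW i > 0 \<longleftrightarrow> i \<in> W"
      using I i by (auto simp: I_def stores_def)
    have "C \<inter> {i..} = (if i \<in> C then insert i (C \<inter> {Suc i..}) else C \<inter> {Suc i..})"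
      by (auto simp: Suc_le_eq le_less)
    then have card: "card (C \<inter> {i..}) = (if i \<in> C then 1 else 0) + card (C \<inter> {Suc i..})"
      using fin by simp
    have all: "(\<forall>v\<in>C. i \<le> v \<longrightarrow> v \<notin> D \<and> v \<in> W) \<longleftrightarrow>
        (\<forall>v\<in>C. Suc i \<le> v \<longrightarrow> v \<notin> D \<and> v \<in> W) \<and> (i \<in> C \<longrightarrow> i \<notin> D \<and> i \<in> W)"
      by (auto simp: Suc_le_eq le_less)
    show "I i (sem check_vertex (setv vV i t))"
      using I ab unfolding I_def card all
      by (cases "i \<in> C"; cases "i \<in> D"; cases "i \<in> W") (simp_all add: check_vertex_def stores_def)
  qed
  then show "vr s' vCnt = card C" "vr s' vOk > 0 \<longleftrightarrow> D \<inter> C = {} \<and> C \<subseteq> W"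
    by (auto simp: I_def)
qed

lemma test_subset_correct:
  assumes s: "graph_state n m e s" "stores s aX n X" "X \<subseteq> V" and s': "s' = sem test_subset s"
    and D: "D = select (vr s vQ) X n (vr s vY)"
  shows "stores s' aC n (candidate E X D)" "vr s' vCnt = card (candidate E X D)"
    "vr s' vOk > 0 \<longleftrightarrow> accepted E X D"
proof -
  define s0 where "s0 = sem (Plus vZ vY vZero) s"
  define s1 where "s1 = sem (For vV vN select_vertex) s0"
  define s2 where "s2 = sem (For vI vM add_neighbours) s1"
  define s3 where "s3 = sem (For vI vM mark_witnessed) s2"
  define s4 where "s4 = sem (Const vCnt 0) (sem (Const vOk 1) s3)"
  let ?C = "candidate E X D"
  have "graph_state n m e s0" "stores s0 aX n X" "D = select (vr s0 vQ) X n (vr s0 vZ)"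
    using s D by (simp_all add: s0_def graph_state_def)
  note 0 = this
  note 1 = select_vertices[OF 0(1,2) s1_def 0(3)]
  have gs1: "graph_state n m e s1" unfolding s1_def
    by (rule graph_state_frame[OF 0(1)]) (auto simp: select_vertex_def)
  have gs2: "graph_state n m e s2" unfolding s2_def
    by (rule graph_state_frame[OF gs1]) (auto simp: add_neighbours_def)
  have gs3: "graph_state n m e s3" unfolding s3_def
    by (rule graph_state_frame[OF gs2]) (auto simp: mark_witnessed_def)
  have C2: "stores s2 aC n ?C"
    using add_all_neighbours[OF gs1 1(1,2) s2_def] by (simp add: candidate_def)
  have D2: "stores s2 aD n D" unfolding s2_def
    by (rule stores_frame[OF 1(2)]) (simp add: add_neighbours_def)
  have W2: "stores s2 aW n {}" unfolding s2_def
    by (rule stores_frame[OF 1(3)]) (simp add: add_neighbours_def)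
  have C3: "stores s3 aC n ?C" unfolding s3_def
    by (rule stores_frame[OF C2]) (simp add: mark_witnessed_def)
  have D3: "stores s3 aD n D" unfolding s3_def
    by (rule stores_frame[OF D2]) (simp add: mark_witnessed_def)
  note W3 = mark_all_witnessed[OF gs2 C2 W2 s3_def]
  have s': "s' = sem (For vV vN check_vertex) s4"
    unfolding s' test_subset_def s4_def s3_def s2_def s1_def s0_def by (simp only: sem.simps)
  \<comment> \<open>\<open>stores\<close> constrains only cells below \<open>n\<close>; the count is
    the full cardinality because no element of the candidate lies beyond them.\<close>
  have sub: "?C \<subseteq> V" using s(3) endpoints by (fastforce simp: candidate_def edge_iff)
  have 4: "graph_state n m e s4" "stores s4 aC n ?C" "stores s4 aD n D"
    "stores s4 aW n {v. \<exists>w. {v, w} \<in> E \<and> w \<notin> ?C}" "vr s4 vOk = 1" "vr s4 vCnt = 0"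
    using gs3 C3 D3 W3 by (simp_all add: s4_def graph_state_def stores_def)
  note 5 = check_vertices[OF 4(1-4) sub 4(5,6) s']
  show "vr s' vCnt = card ?C" by (rule 5)
  show "vr s' vOk > 0 \<longleftrightarrow> accepted E X D" unfolding 5 accepted_def by blast
  show "stores s' aC n ?C" unfolding s'
    by (rule stores_frame[OF 4(2)]) (simp add: check_vertex_def)
qed

section \<open>Enumerating the minimal covers and comparing their sizes\<close>

definition listing :: "nat set \<Rightarrow> nat list" where
  "listing C = rev (filter (\<lambda>v. v \<in> C) [0..<n])"

lemma listing_props:
  assumes "C \<subseteq> V"
  shows "distinct (listing C)" "set (listing C) = C" "length (listing C) = card C"
proof -
  show *: "distinct (listing C)" "set (listing C) = C" using assms by (auto simp: listing_def)
  show "length (listing C) = card C" using distinct_card[OF *(1)] *(2) by simp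
qed

lemma print_cover_correct:
  assumes s: "graph_state n m e s" "stores s aC n C" "vr s vCnt = card C"
  shows "sout (sem print_cover s) = sout s @ (if vr s vOk > 0 then card C # listing C else [])"
proof -
  let ?c = "Get vA aC vV ;; Cond vA (Output vV) Skip"
  define s0 where "s0 = sem (Output vCnt) s"
  define I where "I i s' \<longleftrightarrow> stores s' aC n C \<and>
    sout s' = sout s @ card C # rev (filter (\<lambda>v. v \<in> C) [i..<n])" for i s'
  have "I 0 (loop (\<lambda>i s. sem ?c (setv vV i s)) n s0)"
  proof (rule loop_inv[where I = I])
    show "I n s0" using s by (simp add: I_def s0_def stores_def)
    fix i t assume i: "i < n" and I: "I (Suc i) t"
    have "ar t aC i > 0 \<longleftrightarrow> i \<in> C" using I i by (simp add: I_def stores_def)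
    then show "I i (sem ?c (setv vV i t))"
      using I i by (simp add: I_def stores_def upt_conv_Cons)
  qed
  moreover have "vr s0 vN = n" using s(1) by (simp add: s0_def graph_state_def)
  ultimately have "sout (sem (For vV vN ?c) s0) = sout s @ card C # listing C"
    by (simp add: I_def listing_def)
  then show ?thesis unfolding s0_def by (simp add: print_cover_def)
qed

lemma print_all_covers:
  assumes s: "graph_state n m e s" "stores s aX n X" "vr s vQ = 2 ^ card X" "sout s = []"
    and X: "vertex_cover V E X"
  shows "lists_family (sout (sem (For vY vQ (test_subset ;; print_cover)) s))
    {C. minimal_vertex_cover V E C}"
proof -
  let ?c = "test_subset ;; print_cover"
  let ?Q = "2 ^ card X :: nat"
  have XV: "X \<subseteq> V" using X by (simp add: vertex_cover_def)
  define D where "D = select ?Q X n"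
  define ls where "ls i = map (\<lambda>y. listing (candidate E X (D y)))
    (filter (\<lambda>y. accepted E X (D y)) (rev [i..<?Q]))" for i
  have CV: "candidate E X S \<subseteq> V" for S
    using candidate_cover[OF graph X] by (simp add: vertex_cover_def)
  define I where "I i s \<longleftrightarrow> graph_state n m e s \<and> stores s aX n X \<and> vr s vQ = ?Q \<and>
    sout s = concat (map (\<lambda>l. length l # l) (ls i))" for i s
  have "I 0 (loop (\<lambda>i s. sem ?c (setv vY i s)) ?Q s)"
  proof (rule loop_inv[where I = I])
    show "I ?Q s" using s by (simp add: I_def ls_def)
    fix i t assume i: "i < ?Q" and I: "I (Suc i) t"
    let ?s = "setv vY i t"
    define t1 where "t1 = sem test_subset ?s"
    have s: "graph_state n m e ?s" "stores ?s aX n X" "D i = select (vr ?s vQ) X n (vr ?s vY)"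
      using I by (simp_all add: I_def D_def)
    note t = test_subset_correct[OF s(1,2) XV t1_def s(3)]
    have gs: "graph_state n m e t1" unfolding t1_def
      by (rule graph_state_frame[OF s(1)]) (auto simp: com_defs)
    have "stores (sem ?c ?s) aX n X"
      by (rule stores_frame[OF s(2)]) (auto simp: com_defs)
    moreover have "graph_state n m e (sem ?c ?s)"
      by (rule graph_state_frame[OF s(1)]) (auto simp: com_defs)
    moreover have "vQ \<notin> writes ?c" by (simp add: com_defs)
    then have "vr (sem ?c ?s) vQ = vr ?s vQ" by (rule vr_frame)
    then have "vr (sem ?c ?s) vQ = ?Q" using I by (simp only: I_def, simp)
    moreover have "silent test_subset" by (simp add: com_defs)
    then have "sout t1 = concat (map (\<lambda>l. length l # l) (ls (Suc i)))"
      unfolding t1_def using I by (simp add: sout_frame I_def)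
    then have "sout (sem ?c ?s) = concat (map (\<lambda>l. length l # l) (ls i))"
      using print_cover_correct[OF gs t(1,2)] t(3) i listing_props(3)[OF CV]
      by (simp add: t1_def[symmetric] ls_def upt_conv_Cons)
    ultimately show "I i (sem ?c (setv vY i t))" by (simp only: I_def)
  qed
  then have out: "sout (sem (For vY vQ ?c) s) = concat (map (\<lambda>l. length l # l) (ls 0))"
    unfolding sem.simps(11) s(3) by (simp only: I_def)
  have sets: "map set (ls 0) = map (\<lambda>y. candidate E X (D y))
      (filter (\<lambda>y. accepted E X (D y)) (rev [0..<?Q]))"
    using listing_props(2)[OF CV] by (simp add: ls_def)
  have bij: "bij_betw D {..<?Q} (Pow X)" unfolding D_def by (rule bij_betw_select[OF XV])
  \<comment> \<open>No cover is printed twice: numbers map injectively to subsets, and accepted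
    subsets map injectively to covers.\<close>
  have "inj_on (candidate E X \<circ> D) {y \<in> {..<?Q}. accepted E X (D y)}"
  proof (rule comp_inj_on)
    show "inj_on D {y \<in> {..<?Q}. accepted E X (D y)}"
      using bij by (auto simp: bij_betw_def intro: inj_on_subset)
    show "inj_on (candidate E X) (D ` {y \<in> {..<?Q}. accepted E X (D y)})"
      by (rule inj_on_subset[OF inj_on_candidate]) (use bij in \<open>auto simp: bij_betw_def\<close>)
  qed
  then have "distinct (map set (ls 0))" unfolding sets
    by (simp add: distinct_map comp_def lessThan_atLeast0)
  moreover have "set (map set (ls 0)) = {C. minimal_vertex_cover V E C}"
    unfolding sets minimal_covers_eq[OF graph X] D_def subsets_eq_select[OF XV]
    by (auto simp: image_image)
  moreover have "\<forall>l\<in>set (ls 0). distinct l" using listing_props(1)[OF CV] by (auto simp: ls_def)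
  ultimately show ?thesis unfolding lists_family_def out by blast
qed

text \<open>Since \<open>X\<close> is a minimal cover, two minimal covers of different sizes exist
  iff one of them differs in size from \<open>X\<close>.\<close>

lemma compare_all_sizes:
  assumes s: "graph_state n m e s" "stores s aX n X" "vr s vQ = 2 ^ card X" "vr s vSize = card X"
      "vr s vBad = 0"
    and X: "vertex_cover V E X" "card X = vc V E"
  shows "vr (sem (For vY vQ (test_subset ;; compare_size)) s) vBad > 0 \<longleftrightarrow> \<not> well_covered V E"
proof -
  let ?c = "test_subset ;; compare_size"
  let ?Q = "2 ^ card X :: nat"
  have XV: "X \<subseteq> V" using X by (simp add: vertex_cover_def)
  define D where "D = select ?Q X n"
  define bad where "bad y \<longleftrightarrow> accepted E X (D y) \<and> card (candidate E X (D y)) \<noteq> card X" for y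
  define I where "I i s \<longleftrightarrow> graph_state n m e s \<and> stores s aX n X \<and> vr s vQ = ?Q \<and>
    vr s vSize = card X \<and> (vr s vBad > 0 \<longleftrightarrow> (\<exists>y<?Q. i \<le> y \<and> bad y))" for i s
  have "I 0 (loop (\<lambda>i s. sem ?c (setv vY i s)) ?Q s)"
  proof (rule loop_inv[where I = I])
    show "I ?Q s" using s by (simp add: I_def)
    fix i t assume i: "i < ?Q" and I: "I (Suc i) t"
    let ?s = "setv vY i t"
    define t1 where "t1 = sem test_subset ?s"
    have s: "graph_state n m e ?s" "stores ?s aX n X" "D i = select (vr ?s vQ) X n (vr ?s vY)"
      using I by (simp_all add: I_def D_def)
    note t = test_subset_correct[OF s(1,2) XV t1_def s(3)]
    have "stores (sem ?c ?s) aX n X"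
      by (rule stores_frame[OF s(2)]) (auto simp: com_defs)
    moreover have "graph_state n m e (sem ?c ?s)"
      by (rule graph_state_frame[OF s(1)]) (auto simp: com_defs)
    moreover have "vQ \<notin> writes ?c" "vSize \<notin> writes ?c" by (simp_all add: com_defs)
    then have "vr (sem ?c ?s) vQ = vr ?s vQ" "vr (sem ?c ?s) vSize = vr ?s vSize"
      by (blast intro: vr_frame)+
    then have "vr (sem ?c ?s) vQ = ?Q" "vr (sem ?c ?s) vSize = card X"
      using I by (simp_all only: I_def, simp_all)
    moreover have "vr (sem ?c ?s) vBad > 0 \<longleftrightarrow> (\<exists>y<?Q. i \<le> y \<and> bad y)"
    proof -
      have "vBad \<notin> writes test_subset" "vSize \<notin> writes test_subset" by (simp_all add: com_defs)
      then have "vr t1 vSize = card X" "vr t1 vBad > 0 \<longleftrightarrow> (\<exists>y<?Q. Suc i \<le> y \<and> bad y)"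
        unfolding t1_def using I by (simp_all add: vr_frame I_def)
      then have "vr (sem ?c ?s) vBad > 0 \<longleftrightarrow> (\<exists>y<?Q. Suc i \<le> y \<and> bad y) \<or> bad i"
        using t by (auto simp: t1_def[symmetric] compare_size_def bad_def)
      also have "\<dots> \<longleftrightarrow> (\<exists>y<?Q. i \<le> y \<and> bad y)"
        using i by (metis Suc_le_eq le_less)
      finally show ?thesis .
    qed
    ultimately show "I i (sem ?c (setv vY i t))" by (simp only: I_def)
  qed
  then have out: "vr (sem (For vY vQ ?c) s) vBad > 0 \<longleftrightarrow> (\<exists>y<?Q. bad y)"
    unfolding sem.simps(11) s(3) by (simp add: I_def)
  have "{C. minimal_vertex_cover V E C} =
      candidate E X ` D ` {y. y < ?Q \<and> accepted E X (D y)}"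
    unfolding minimal_covers_eq[OF graph X(1)] D_def subsets_eq_select[OF XV] ..
  then have "(\<exists>y<?Q. bad y) \<longleftrightarrow> (\<exists>C \<in> {C. minimal_vertex_cover V E C}. card C \<noteq> card X)"
    by (auto simp: bad_def)
  also have "\<dots> \<longleftrightarrow> \<not> well_covered V E"
    using minimum_cover_minimal[OF graph X] by (auto simp: well_covered_def) metis
  finally show ?thesis using out by simp
qed

section \<open>Total costs and the passage from encoded graphs to machine programs\<close>

lemma cost_read_graph:
  "cost read_graph (init (n # m # xs)) \<le> 6 + 17 * m"
proof -
  let ?c = "For vI vM (Input vU ;; Input vW ;; Put aU vI vU ;; Put aV vI vW)"
  let ?s = "sem (Input vM) (sem (Input vN) (sem (Const vOne 1) (init (n # m # xs))))"
  have "cost read_graph (init (n # m # xs)) = 3 + cost ?c ?s"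
    by (simp only: read_graph_def cost.simps sem.simps)
  also have "cost ?c ?s \<le> cost_bound ?c (vr ?s)" by (rule cost_le_bound) auto
  also have "cost_bound ?c (vr ?s) = 3 + 17 * m" by (simp add: init_def)
  finally show ?thesis by simp
qed

text \<open>Each subset costs a constant number of scans over vertices and edges. Of the 203, the
  200 is a rounded static bound per subset, and 3 absorbs the overhead of the loop.\<close>

lemma cost_test_all:
  assumes "graph_state n m e s" "vr s vQ = 2 ^ vc V E" "c = print_cover \<or> c = compare_size"
  shows "cost (For vY vQ (test_subset ;; c)) s \<le> 203 * (2 ^ vc V E * (m + n + 1))"
proof -
  let ?\<sigma> = "(\<lambda>_. 0)(vN := n, vM := m, vQ := vr s vQ)"
  let ?c = "For vY vQ (test_subset ;; c)"
  have "cost ?c s \<le> cost_bound ?c ?\<sigma>"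
    by (rule cost_le_bound) (use assms in \<open>auto simp: com_defs graph_state_def\<close>)
  also have "\<dots> \<le> 3 + vr s vQ * (200 * (n + m + 1))"
    using assms(3) by (auto simp: com_defs)
  also have "\<dots> = 3 + 200 * (2 ^ vc V E * (m + n + 1))"
    by (simp only: assms(2) ac_simps)
  also have "\<dots> \<le> 203 * (2 ^ vc V E * (m + n + 1))"
  proof -
    have "m + n + 1 \<le> 2 ^ vc V E * (m + n + 1)" by (rule le_power_2_mult)
    then show ?thesis by linarith
  qed
  finally show ?thesis .
qed

end

text \<open>Distinctness of the edge list identifies its length with the number of edges announced
  in the input. The list is reversed because the first edge read receives the highest index.\<close>

lemma encodes_graphE:
  assumes "encodes_graph xs V E"
  obtains es where "xs = card V # card E # concat (map (\<lambda>(u, v). [u, v]) es)"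
    "length es = card E" "indexed_graph (card V) (card E) (\<lambda>i. rev es ! i)" "V = {..<card V}"
    "E = (\<lambda>i. {fst (rev es ! i), snd (rev es ! i)}) ` {..<card E}"
proof -
  obtain es where es: "distinct (map (\<lambda>(u, v). {u, v}) es)" "set (map (\<lambda>(u, v). {u, v}) es) = E"
    "xs = card V # card E # concat (map (\<lambda>(u, v). [u, v]) es)"
    and G: "simple_graph V E" "V = {..<card V}"
    using assms by (auto simp: encodes_graph_def)
  have len: "length es = card E" using distinct_card[OF es(1)] es(2) by simp
  have "(!) (rev es) ` {..<card E} = set es"
    using len nth_image[of "card E" "rev es"] by (simp add: lessThan_atLeast0)
  then have "(\<lambda>i. case rev es ! i of (u, v) \<Rightarrow> {u, v}) ` {..<card E} = E"
    using es(2) by (metis image_image list.set_map)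
  then have E: "E = (\<lambda>i. {fst (rev es ! i), snd (rev es ! i)}) ` {..<card E}"
    by (simp add: case_prod_beta)
  have "indexed_graph (card V) (card E) (\<lambda>i. rev es ! i)"
  proof
    fix i assume "i < card E"
    then have "{fst (rev es ! i), snd (rev es ! i)} \<in> E" by (subst E) blast
    with G(1) have *: "{fst (rev es ! i), snd (rev es ! i)} \<subseteq> V"
      "card {fst (rev es ! i), snd (rev es ! i)} = 2"
      unfolding simple_graph_def by blast+
    have "v < card V" if "v \<in> V" for v using that by (subst (asm) G(2)) simp
    moreover from *(2) have "fst (rev es ! i) \<noteq> snd (rev es ! i)" by auto
    ultimately show "fst (rev es ! i) < card V \<and> snd (rev es ! i) < card V \<and>
        fst (rev es ! i) \<noteq> snd (rev es ! i)" using *(1) by simp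
  qed
  from that[OF es(3) len this G(2) E] show ?thesis .
qed

lemma read_and_find_cover:
  assumes "encodes_graph xs V E"
  obtains e X s where "indexed_graph (card V) (card E) e"
    "V = {..<card V}" "E = (\<lambda>i. {fst (e i), snd (e i)}) ` {..<card E}"
    "s = sem find_cover (sem read_graph (init xs))" "graph_state (card V) (card E) e s"
    "vertex_cover V E X" "card X = vc V E" "stores s aX (card V) X"
    "vr s vQ = 2 ^ card X" "vr s vSize = card X" "vr s vBad = 0" "sout s = []"
    "cost read_graph (init xs) + cost find_cover (sem read_graph (init xs))
      \<le> 400 * (2 ^ vc V E * (card E + card V + 1))"
proof -
  from encodes_graphE[OF assms] obtain es where
    xs: "xs = card V # card E # concat (map (\<lambda>(u, v). [u, v]) es)" "length es = card E"
    and ig: "indexed_graph (card V) (card E) (\<lambda>i. rev es ! i)"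
    and V: "V = {..<card V}"
    and E: "E = (\<lambda>i. {fst (rev es ! i), snd (rev es ! i)}) ` {..<card E}" .
  let ?e = "\<lambda>i. rev es ! i" and ?s = "sem read_graph (init xs)"
  interpret indexed_graph "card V" "card E" ?e by (rule ig)
  have gs: "graph_state (card V) (card E) ?e ?s" unfolding xs(1) by (rule read_graph_correct[OF xs(2)])
  define s where "s = sem find_cover ?s"
  from find_cover_correct[OF gs s_def, folded V E] obtain X where X: "vertex_cover V E X"
    "card X = vc V E" "stores s aX (card V) X" "vr s vQ = 2 ^ card X" "vr s vSize = card X"
    and cost: "cost find_cover ?s
      \<le> 20 + 2 * 2 ^ vc V E * (150 * (card V + card E + 1)) + 20 * (card V + 1)" .
  have "graph_state (card V) (card E) ?e s" unfolding s_def
    by (rule graph_state_frame[OF gs]) (auto simp: com_defs)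
  moreover have "vBad \<notin> writes read_graph" "vBad \<notin> writes find_cover"
    "silent read_graph" "silent find_cover" by (simp_all add: com_defs)
  then have "vr s vBad = 0" "sout s = []"
    by (simp_all add: s_def vr_frame sout_frame) (simp_all add: init_def)
  moreover have "cost read_graph (init xs) + cost find_cover ?s
      \<le> 400 * (2 ^ vc V E * (card E + card V + 1))"
  proof -
    define N where "N = card E + card V + 1"
    have N: "card E \<le> N" "card V + card E + 1 = N" "card V + 1 \<le> N" "1 \<le> N" by (simp_all add: N_def)
    have "N \<le> 2 ^ vc V E * N" by (rule le_power_2_mult)
    moreover have "cost read_graph (init xs) \<le> 6 + 17 * card E"
      unfolding xs(1) by (rule cost_read_graph)
    moreover have "cost find_cover ?s \<le> 20 + 300 * (2 ^ vc V E * N) + 20 * N"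
    proof -
      have "2 * 2 ^ vc V E * (150 * N) = 300 * (2 ^ vc V E * N)" by simp
      moreover have "20 * (card V + 1) \<le> 20 * N" using N(3) by simp
      ultimately show ?thesis using cost[unfolded N(2)] by (simp only:)
    qed
    \<comment> \<open>The summands contribute \<open>6 + 17 + 20 + 300 + 20 = 363\<close> multiples
      of \<open>2 ^ vc V E * N\<close> at most.\<close>
    ultimately have "cost read_graph (init xs) + cost find_cover ?s \<le> 400 * (2 ^ vc V E * N)"
      using N by linarith
    then show ?thesis by (simp add: N_def)
  qed
  ultimately show ?thesis using that[OF ig V E s_def _ X] by blast
qed

lemma enumerate_covers_correct:
  assumes "encodes_graph xs V E"
  shows "lists_family (sout (sem enumerate_covers (init xs))) {C. minimal_vertex_cover V E C}"
    "cost enumerate_covers (init xs) \<le> 700 * (2 ^ vc V E * (card E + card V + 1))"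
proof -
  obtain e X s where ig: "indexed_graph (card V) (card E) e"
    and VE: "V = {..<card V}" "E = (\<lambda>i. {fst (e i), snd (e i)}) ` {..<card E}"
    and s: "s = sem find_cover (sem read_graph (init xs))" "graph_state (card V) (card E) e s"
    and X: "vertex_cover V E X" "card X = vc V E" "stores s aX (card V) X"
      "vr s vQ = 2 ^ card X" "vr s vSize = card X" "vr s vBad = 0" "sout s = []"
    and cost: "cost read_graph (init xs) + cost find_cover (sem read_graph (init xs))
      \<le> 400 * (2 ^ vc V E * (card E + card V + 1))"
    using read_and_find_cover[OF assms] .
  interpret indexed_graph "card V" "card E" e by (rule ig)
  have "sem enumerate_covers (init xs) = sem (For vY vQ (test_subset ;; print_cover)) s"
    unfolding enumerate_covers_def s(1) by (simp only: sem.simps)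
  then show "lists_family (sout (sem enumerate_covers (init xs))) {C. minimal_vertex_cover V E C}"
    using print_all_covers[OF s(2) X(3,4,7), folded VE, OF X(1)] by (simp only:)
  have "vr s vQ = 2 ^ vc V E" using X(2,4) by simp
  from cost_test_all[OF s(2), folded VE, OF this, of print_cover]
  have "cost (For vY vQ (test_subset ;; print_cover)) s
    \<le> 203 * (2 ^ vc V E * (card E + card V + 1))" by blast
  then show "cost enumerate_covers (init xs) \<le> 700 * (2 ^ vc V E * (card E + card V + 1))"
    using cost unfolding enumerate_covers_def cost.simps(9) s(1)[symmetric] by linarith
qed

lemma decide_well_covered_correct:
  assumes "encodes_graph xs V E"
  shows "sout (sem decide_well_covered (init xs)) = [if well_covered V E then 1 else 0]"
    "cost decide_well_covered (init xs) \<le> 700 * (2 ^ vc V E * (card E + card V + 1))"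
proof -
  obtain e X s where ig: "indexed_graph (card V) (card E) e"
    and VE: "V = {..<card V}" "E = (\<lambda>i. {fst (e i), snd (e i)}) ` {..<card E}"
    and s: "s = sem find_cover (sem read_graph (init xs))" "graph_state (card V) (card E) e s"
    and X: "vertex_cover V E X" "card X = vc V E" "stores s aX (card V) X"
      "vr s vQ = 2 ^ card X" "vr s vSize = card X" "vr s vBad = 0" "sout s = []"
    and cost: "cost read_graph (init xs) + cost find_cover (sem read_graph (init xs))
      \<le> 400 * (2 ^ vc V E * (card E + card V + 1))"
    using read_and_find_cover[OF assms] .
  interpret indexed_graph "card V" "card E" e by (rule ig)
  define s' where "s' = sem (For vY vQ (test_subset ;; compare_size)) s"
  have run: "sem decide_well_covered (init xs) = sem (Output vT) (sem (Minus vT vOne vBad) s')"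
    unfolding decide_well_covered_def s(1) s'_def by (simp only: sem.simps)
  have "vr s' vBad > 0 \<longleftrightarrow> \<not> well_covered V E"
    using compare_all_sizes[OF s(2) X(3-6), folded VE, OF X(1,2)] by (simp only: s'_def)
  moreover have "graph_state (card V) (card E) e s'" unfolding s'_def
    by (rule graph_state_frame[OF s(2)]) (auto simp: com_defs)
  moreover have "silent (For vY vQ (test_subset ;; compare_size))" by (simp add: com_defs)
  then have "sout s' = []" unfolding s'_def using X(7) by (simp only: sout_frame)
  ultimately show "sout (sem decide_well_covered (init xs)) = [if well_covered V E then 1 else 0]"
    unfolding run by (auto simp: graph_state_def)
  have "vr s vQ = 2 ^ vc V E" using X(2,4) by simp
  from cost_test_all[OF s(2), folded VE, OF this, of compare_size]
  have "cost (For vY vQ (test_subset ;; compare_size)) s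
    \<le> 203 * (2 ^ vc V E * (card E + card V + 1))" by blast
  moreover have "card E + card V + 1 \<le> 2 ^ vc V E * (card E + card V + 1)" by (rule le_power_2_mult)
  ultimately show "cost decide_well_covered (init xs) \<le> 700 * (2 ^ vc V E * (card E + card V + 1))"
    using cost unfolding decide_well_covered_def cost.simps s(1)[symmetric] by linarith
qed

text \<open>A nonempty \<open>V\<close> gives
  \<open>card E + card V + 1 \<le> 2 * (card E + card V)\<close>, which doubles 700; the rest of
  1402 absorbs the initial machine instruction.\<close>

lemma ram_running_time:
  assumes "well_formed 0 c" "encodes_graph xs V E" "V \<noteq> {}"
    "cost c (init xs) \<le> 700 * (2 ^ vc V E * (card E + card V + 1))"
  shows "running_time (ram c) xs \<le> 1402 * (2 ^ vc V E * (card E + card V))"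
proof -
  have "finite V" using assms(2) by (simp add: encodes_graph_def simple_graph_def)
  then have "1 \<le> card E + card V" using assms(3) by (simp add: Suc_le_eq card_gt_0_iff)
  moreover from this have "2 ^ vc V E * (card E + card V + 1) \<le> 2 ^ vc V E * (2 * (card E + card V))"
    by (intro mult_le_mono2) simp
  moreover have "card E + card V \<le> 2 ^ vc V E * (card E + card V)" by (rule le_power_2_mult)
  ultimately show ?thesis using ram_correct(3)[OF assms(1), of xs] assms(4) by linarith
qed

lemma card_edges_le:
  assumes "simple_graph V E"
  shows "card E \<le> card V * card V"
proof -
  have "finite V" using assms by (simp add: simple_graph_def)
  have "E \<subseteq> (\<lambda>(u, v). {u, v}) ` (V \<times> V)" by (auto elim!: edgeE[OF assms])
  then have "card E \<le> card ((\<lambda>(u, v). {u, v}) ` (V \<times> V))"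
    using \<open>finite V\<close> by (intro card_mono) auto
  also have "\<dots> \<le> card (V \<times> V)" using \<open>finite V\<close> by (intro card_image_le) auto
  finally show ?thesis by (simp add: card_cartesian_product)
qed

text \<open>The definition of \<open>fpt_time\<close> asks for a computable parameter function;
  repeated doubling provides it.\<close>

lemma computable_power_2: "computable (\<lambda>k. 2 ^ k)"
proof -
  let ?c = "Input vN ;; Const vP 1 ;; For vI vN (Plus vP vP vP) ;; Output vP"
  have "well_formed 0 ?c" by simp
  moreover have "sout (sem ?c (init [k])) = [2 ^ k]" for k
  proof -
    have "vr (loop (\<lambda>i s. sem (Plus vP vP vP) (setv vI i s)) k s) vP = 2 ^ k * vr s vP \<and>
        sout (loop (\<lambda>i s. sem (Plus vP vP vP) (setv vI i s)) k s) = sout s" for s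
      by (induction k arbitrary: s) simp_all
    then show ?thesis by (simp add: init_def)
  qed
  ultimately show ?thesis unfolding computable_def using ram_correct(1,2)[of ?c] by metis
qed

theorem theorem1:
  "(\<exists>p. enumerates_minimal_vertex_covers p \<and>
        time_O p (\<lambda>V E. 2 ^ vc V E * (card E + card V))) \<and>
   (\<exists>p. decides_well_covered p \<and> time_Ostar p vc (\<lambda>k. 2 ^ k) \<and> fpt_time p vc)"
proof
  let ?p = "ram enumerate_covers"
  have "enumerates_minimal_vertex_covers ?p"
    unfolding enumerates_minimal_vertex_covers_def ram_correct(2)[OF well_formed_enumerate_covers]
    using ram_correct(1)[OF well_formed_enumerate_covers] enumerate_covers_correct(1) by blast
  moreover have "time_O ?p (\<lambda>V E. 2 ^ vc V E * (card E + card V))"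
    unfolding time_O_def
    using ram_running_time[OF well_formed_enumerate_covers] enumerate_covers_correct(2) by blast
  ultimately show "\<exists>p. enumerates_minimal_vertex_covers p \<and>
      time_O p (\<lambda>V E. 2 ^ vc V E * (card E + card V))" by blast
next
  let ?p = "ram decide_well_covered"
  have "decides_well_covered ?p"
    unfolding decides_well_covered_def ram_correct(2)[OF well_formed_decide_well_covered]
    using ram_correct(1)[OF well_formed_decide_well_covered] decide_well_covered_correct(1) by blast
  moreover have star: "time_Ostar ?p vc (\<lambda>k. 2 ^ k)"
    unfolding time_Ostar_def time_O_def
  proof (intro exI allI impI)
    fix V E xs assume xs: "encodes_graph xs V E" "V \<noteq> {}"
    have G: "simple_graph V E" using xs(1) by (simp add: encodes_graph_def)
    have "card V \<le> card V * card V" by (cases "card V") simp_all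
    then have "card E + card V \<le> 2 * card V ^ 2"
      using card_edges_le[OF G] unfolding power2_eq_square by linarith
    then have "2 ^ vc V E * (card E + card V) \<le> 2 ^ vc V E * (2 * card V ^ 2)" by simp
    \<comment> \<open>The exponent 2 and the factor \<open>2804 = 2 * 1402\<close> come from
      \<open>card E + card V \<le> 2 * card V ^ 2\<close>.\<close>
    then show "running_time ?p xs \<le> 2804 * (2 ^ vc V E * card V ^ 2)"
      using ram_running_time[OF well_formed_decide_well_covered xs decide_well_covered_correct(2)[OF xs(1)]]
      by linarith
  qed
  moreover have "fpt_time ?p vc"
    unfolding fpt_time_def using star computable_power_2 by blast
  ultimately show "\<exists>p. decides_well_covered p \<and> time_Ostar p vc (\<lambda>k. 2 ^ k) \<and> fpt_time p vc"
    by blast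
qed

end
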